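(* Let $p:\mathbb{N}\to[0,1]$, $n\mapsto p_n$, be middling of exponent $10$, i.e. $-\liminf_{n\to\infty}\log_n p_n<\tfrac{1}{10}$ and $\lim_{n\to\infty}p_n=0$. Then $$\lim_{n\to\infty}\ \mathbb{P}_{\Gamma\in\Omega^{[n]}_{p_n}}\Big(\kappa^1_{\mathbb{F}_2}(\Gamma)=\delta^1(\Gamma)\Big)=1 .$$
   Context: Graphs are finite and simple, $\Gamma=(V(\Gamma),E(\Gamma))$. $\mathbb{N}=\{1,2,\dots\}$ and $[n]=\{1,\dots,n\}$. $\Omega^{[n]}_{p}$ denotes the Erdős–Rényi probability space of random graphs on vertex set $[n]$ in which each of the $\binom n2$ possible edges is present independently with probability $p$. For $C\subseteq V(\Gamma)$, $\Gamma-C$ is the subgraph of $\Gamma$ induced on $V(\Gamma)\setminus C$. For a vertex $v$, $N_\Gamma(v)=\{u:\{u,v\}\in E(\Gamma)\}$, and for a vertex set $I$, $N_\Gamma(I)=\bigcap_{c\in I}N_\Gamma(c)$ is the set of common neighbors. $\mathrm{Cl}(\Gamma)$ is the clique complex of $\Gamma$: the simplicial complex on $V(\Gamma)$ whose set of $i$-simplices $\mathrm{Cl}(\Gamma)[i]$ consists of the $(i+1)$-element vertex subsets that are pairwise adjacent. For a field $\mathbb{K}$ and an integer $i\ge 0$, $$\kappa^i_{\mathbb{K}}(\Gamma)=\min\{|C| : C\subseteq V(\Gamma),\ \tilde H^i(\mathrm{Cl}(\Gamma-C);\mathbb{K})\ne 0\},$$ $$\delta^i(\Gamma)=\min\{|N_\Gamma(I)|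 : I\in \mathrm{Cl}(\Gamma)[i]\},$$ where $\tilde H^i$ is reduced simplicial cohomology and the minimum over the empty set is $+\infty$. $\mathbb{F}_2$ is the field with two elements. *)

theory Defs
  imports
    "HOL-Probability.Probability"
    "HOL-Algebra.Elementary_Groups"
    "HOL-Library.Z2"
begin

section \<open>Simple graphs\<close>

record 'v sgraph =
  verts :: "'v set"
  edges :: "'v set set"

definition finite_simple_graph :: "'v sgraph \<Rightarrow> bool" where
  "finite_simple_graph G \<longleftrightarrow>
     finite (verts G) \<and> (\<forall>e\<in>edges G. e \<subseteq> verts G \<and> card e = 2)"

definition delete_verts :: "'v sgraph \<Rightarrow> 'v set \<Rightarrow> 'v sgraph" where
  "delete_verts G C =
     \<lparr>verts = verts G - C, edges = {e \<in> edges G. e \<subseteq> verts G - C}\<rparr>"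

definition nbrs :: "'v sgraph \<Rightarrow> 'v \<Rightarrow> 'v set" where
  "nbrs G v = {u. {u, v} \<in> edges G}"

definition common_nbrs :: "'v sgraph \<Rightarrow> 'v set \<Rightarrow> 'v set" where
  "common_nbrs G I = (\<Inter>c\<in>I. nbrs G c)"

section \<open>Reduced simplicial cohomology\<close>

text \<open>
  A simplicial complex is represented by the set of its simplices, the empty simplex (of
  dimension \<open>-1\<close>) included; the cochain complex below is therefore the augmented one.
\<close>

definition simplices :: "'v set set \<Rightarrow> int \<Rightarrow> 'v set set" where
  "simplices X i = {\<sigma> \<in> X. finite \<sigma> \<and> int (card \<sigma>) = i + 1}"

definition clique_complex :: "'v sgraph \<Rightarrow> 'v set set" where
  "clique_complex G =
     {\<sigma>. finite \<sigma> \<and> \<sigma> \<subseteq> verts G \<and> (\<forall>u\<in>\<sigma>. \<forall>v\<in>\<sigma>. u \<noteq> v \<longrightarrow> {u, v} \<in> edges G)}"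

definition cochains :: "'v set set \<Rightarrow> int \<Rightarrow> ('v set \<Rightarrow> 'k::field) set" where
  "cochains X i = {f. \<forall>\<sigma>. \<sigma> \<notin> simplices X i \<longrightarrow> f \<sigma> = 0}"

text \<open>
  Simplices are oriented by the linear order of the vertices: for \<open>v\<^sub>0 < \<dots> < v\<^sub>m\<close> the sign
  attached to the face omitting \<open>v\<^sub>j\<close> is \<open>(-1)^j\<close>.
\<close>

definition coboundary ::
    "'v::linorder set set \<Rightarrow> int \<Rightarrow> ('v set \<Rightarrow> 'k::field) \<Rightarrow> ('v set \<Rightarrow> 'k)" where
  "coboundary X i f = (\<lambda>\<sigma>. if \<sigma> \<in> simplices X (i + 1)
     then (\<Sum>v\<in>\<sigma>. (-1) ^ card {u \<in> \<sigma>. u < v} * f (\<sigma> - {v})) else 0)"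

definition cocycle_group :: "'v::linorder set set \<Rightarrow> int \<Rightarrow> ('v set \<Rightarrow> 'k::field) monoid" where
  "cocycle_group X i =
     \<lparr>carrier = {f \<in> cochains X i. coboundary X i f = (\<lambda>_. 0)},
      monoid.mult = (\<lambda>f g \<sigma>. f \<sigma> + g \<sigma>), one = (\<lambda>_. 0)\<rparr>"

definition coboundaries :: "'v::linorder set set \<Rightarrow> int \<Rightarrow> ('v set \<Rightarrow> 'k::field) set" where
  "coboundaries X i = coboundary X (i - 1) ` cochains X (i - 1)"

text \<open>The type argument is the coefficient field.\<close>

definition reduced_cohomology ::
    "'k::field itself \<Rightarrow> int \<Rightarrow> 'v::linorder set set \<Rightarrow> ('v set \<Rightarrow> 'k) set monoid" where
  "reduced_cohomology K i X = cocycle_group X i Mod coboundaries X i"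

section \<open>The two invariants\<close>

text \<open>The infimum of the empty set in \<^typ>\<open>enat\<close> is \<open>\<infinity>\<close>.\<close>

definition cohom_connectivity ::
    "'k::field itself \<Rightarrow> nat \<Rightarrow> 'v::linorder sgraph \<Rightarrow> enat" where
  "cohom_connectivity K i G =
     (INF C \<in> {C. C \<subseteq> verts G \<and>
        \<not> trivial_group (reduced_cohomology K (int i) (clique_complex (delete_verts G C)))}.
      enat (card C))"

definition min_degree :: "nat \<Rightarrow> 'v sgraph \<Rightarrow> enat" where
  "min_degree i G =
     (INF I \<in> simplices (clique_complex G) (int i). enat (card (common_nbrs G I)))"

section \<open>Random graphs\<close>

definition erdos_renyi :: "nat \<Rightarrow> real \<Rightarrow> nat sgraph pmf" where
  "erdos_renyi n p =
     (let P = {e. e \<subseteq> {1..n} \<and> card e = 2} in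
      map_pmf (\<lambda>X. \<lparr>verts = {1..n}, edges = {e \<in> P. X e}\<rparr>)
        (Pi_pmf P False (\<lambda>_. bernoulli_pmf p)))"

text \<open>
  Logarithms are taken in the extended reals with \<open>log\<^sub>b 0 = -\<infinity>\<close>, since \<^term>\<open>log b 0\<close> is \<open>0\<close>
  in the library.
\<close>

definition elog :: "real \<Rightarrow> real \<Rightarrow> ereal" where
  "elog b x = (if x = 0 then -\<infinity> else ereal (log b x))"

definition middling :: "real \<Rightarrow> (nat \<Rightarrow> real) \<Rightarrow> bool" where
  "middling d p \<longleftrightarrow>
     - liminf (\<lambda>n. elog (real n) (p n)) < ereal (1 / d) \<and> p \<longlonglongrightarrow> 0"

section \<open>The cohomology groups are well defined\<close>

lemma finite_simple_graph_delete_verts: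
  "finite_simple_graph G \<Longrightarrow> finite_simple_graph (delete_verts G C)"
  by (auto simp: finite_simple_graph_def delete_verts_def)

lemma finite_simple_graph_erdos_renyi:
  assumes "G \<in> set_pmf (erdos_renyi n p)"
  shows "finite_simple_graph G \<and> verts G = {1..n}"
proof -
  obtain E where "G = \<lparr>verts = {1..n}, edges = E\<rparr>" "E \<subseteq> {e. e \<subseteq> {1..n} \<and> card e = 2}"
    using assms unfolding erdos_renyi_def Let_def set_map_pmf by blast
  then show ?thesis unfolding finite_simple_graph_def by auto
qed

lemma clique_complex_subset:
  "\<sigma> \<in> clique_complex G \<Longrightarrow> \<tau> \<subseteq> \<sigma> \<Longrightarrow> \<tau> \<in> clique_complex G"
  by (auto simp: clique_complex_def finite_subset subset_iff)

lemma coboundary_in_cochains: "coboundary X i f \<in> cochains X (i + 1)"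
  by (simp add: coboundary_def cochains_def)

lemma coboundary_add:
  "coboundary X i (\<lambda>\<sigma>. f \<sigma> + g \<sigma>) = (\<lambda>\<sigma>. coboundary X i f \<sigma> + coboundary X i g \<sigma>)"
  by (rule ext) (simp add: coboundary_def distrib_left sum.distrib)

lemma coboundary_minus:
  "coboundary X i (\<lambda>\<sigma>. - f \<sigma>) = (\<lambda>\<sigma>. - coboundary X i f \<sigma>)"
  by (rule ext) (simp add: coboundary_def sum_negf)

lemma coboundary_zero: "coboundary X i (\<lambda>\<sigma>. 0) = (\<lambda>\<sigma>. 0)"
  by (rule ext) (simp add: coboundary_def)

lemma coboundary_coboundary:
  assumes X: "\<And>\<sigma> \<tau>. \<sigma> \<in> X \<Longrightarrow> \<tau> \<subseteq> \<sigma> \<Longrightarrow> \<tau> \<in> X"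
  shows "coboundary X (i + 1) (coboundary X i f) = (\<lambda>_. 0)"
proof
  fix \<sigma>
  show "coboundary X (i + 1) (coboundary X i f) \<sigma> = 0"
  proof (cases "\<sigma> \<in> simplices X (i + 1 + 1)")
    case False
    then show ?thesis by (simp add: coboundary_def)
  next
    case True
    then have fin: "finite \<sigma>" by (simp add: simplices_def)
    define s where "s \<tau> v = (-1 :: 'b) ^ card {u \<in> \<tau>. u < v}" for \<tau> and v :: 'a
    define g where "g v w = s \<sigma> v * (s (\<sigma> - {v}) w * f (\<sigma> - {v} - {w}))" for v w
    have face: "\<sigma> - {v} \<in> simplices X (i + 1)" if "v \<in> \<sigma>" for v
    proof -
      have "0 < card \<sigma>" using that fin by (auto simp: card_gt_0_iff)
      then show ?thesis using True that fin X[of \<sigma> "\<sigma> - {v}"]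
        by (auto simp: simplices_def card_Diff_singleton)
    qed
    have anti: "g w v = - g v w" if vw: "v \<in> \<sigma>" "w \<in> \<sigma>" "v < w" for v w
    proof -
      have eq: "{u \<in> \<sigma> - {w}. u < v} = {u \<in> \<sigma>. u < v}" using vw by auto
      have "{u \<in> \<sigma>. u < w} = insert v {u \<in> \<sigma> - {v}. u < w}" using vw by auto
      then have "card {u \<in> \<sigma>. u < w} = Suc (card {u \<in> \<sigma> - {v}. u < w})"
        using fin by simp
      then have "s \<sigma> w = - s (\<sigma> - {v}) w" by (simp add: s_def)
      moreover have "s (\<sigma> - {w}) v = s \<sigma> v" unfolding s_def eq ..
      moreover have "\<sigma> - {v} - {w} = \<sigma> - {w} - {v}" by auto
      ultimately show ?thesis by (simp add: g_def)
    qed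
    let ?L = "{(v, w). v \<in> \<sigma> \<and> w \<in> \<sigma> \<and> v < w}"
    let ?R = "{(v, w). v \<in> \<sigma> \<and> w \<in> \<sigma> \<and> w < v}"
    have finL: "finite ?L"
      by (rule finite_subset[of _ "\<sigma> \<times> \<sigma>"]) (use fin in auto)
    have finR: "finite ?R"
      by (rule finite_subset[of _ "\<sigma> \<times> \<sigma>"]) (use fin in auto)
    have "coboundary X (i + 1) (coboundary X i f) \<sigma> = (\<Sum>v\<in>\<sigma>. \<Sum>w\<in>\<sigma> - {v}. g v w)"
      using True face unfolding coboundary_def g_def s_def
      by (simp add: sum_distrib_left)
    also have "\<dots> = (\<Sum>(v, w)\<in>(SIGMA v:\<sigma>. \<sigma> - {v}). g v w)"
      using fin by (simp add: sum.Sigma)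
    also have "(SIGMA v:\<sigma>. \<sigma> - {v}) = ?L \<union> ?R" by auto
    also have "(\<Sum>(v, w)\<in>?L \<union> ?R. g v w) = (\<Sum>(v, w)\<in>?L. g v w) + (\<Sum>(v, w)\<in>?R. g v w)"
      using finL finR by (intro sum.union_disjoint) auto
    also have "(\<Sum>(v, w)\<in>?R. g v w) = (\<Sum>(v, w)\<in>?L. g w v)"
      by (rule sum.reindex_bij_witness[of _ "\<lambda>(v, w). (w, v)" "\<lambda>(v, w). (w, v)"]) auto
    also have "\<dots> = (\<Sum>(v, w)\<in>?L. - g v w)"
      by (rule sum.cong) (auto simp: anti)
    also have "(\<Sum>(v, w)\<in>?L. g v w) + \<dots> = 0"
      by (simp add: case_prod_unfold sum_negf)
    finally show ?thesis .
  qed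
qed

lemma comm_group_cocycle_group: "comm_group (cocycle_group X i)"
proof (rule comm_groupI)
  fix f assume "f \<in> carrier (cocycle_group X i)"
  then have "(\<lambda>\<sigma>. - f \<sigma>) \<in> carrier (cocycle_group X i)"
    by (simp add: cocycle_group_def cochains_def coboundary_minus)
  then show "\<exists>g\<in>carrier (cocycle_group X i). g \<otimes>\<^bsub>cocycle_group X i\<^esub> f = \<one>\<^bsub>cocycle_group X i\<^esub>"
    by (rule rev_bexI) (simp add: cocycle_group_def)
qed (auto simp: cocycle_group_def cochains_def coboundary_add coboundary_zero algebra_simps)

lemma coboundaries_normal:
  fixes X :: "'v::linorder set set"
  assumes X: "\<And>\<sigma> \<tau>. \<sigma> \<in> X \<Longrightarrow> \<tau> \<subseteq> \<sigma> \<Longrightarrow> \<tau> \<in> X"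
  shows "(coboundaries X i :: ('v set \<Rightarrow> 'k::field) set) \<lhd> cocycle_group X i"
proof -
  let ?Z = "cocycle_group X i :: ('v set \<Rightarrow> 'k) monoid"
  let ?B = "coboundaries X i :: ('v set \<Rightarrow> 'k) set"
  interpret Z: comm_group ?Z by (rule comm_group_cocycle_group)
  have dd: "coboundary X i (coboundary X (i - 1) f) = (\<lambda>_. 0)" for f :: "'v set \<Rightarrow> 'k"
    using coboundary_coboundary[where X = X and i = "i - 1" and f = f] X by simp
  have "subgroup (?B) ?Z"
  proof (rule Z.subgroupI)
    show "?B \<subseteq> carrier ?Z"
      using coboundary_in_cochains[of X "i - 1"] dd
      by (auto simp: coboundaries_def cocycle_group_def)
    show "?B \<noteq> {}"
      by (auto simp: coboundaries_def cochains_def)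
  next
    fix a assume a: "a \<in> ?B"
    then obtain f where f: "f \<in> cochains X (i - 1)" "a = coboundary X (i - 1) f"
      by (auto simp: coboundaries_def)
    let ?b = "coboundary X (i - 1) (\<lambda>\<sigma>. - f \<sigma>)"
    have b: "?b \<in> ?B"
      using f by (auto simp: coboundaries_def cochains_def)
    have in_carrier: "x \<in> carrier ?Z" if "x \<in> ?B" for x
      using that coboundary_in_cochains[of X "i - 1"] dd
      by (auto simp: coboundaries_def cocycle_group_def)
    have "inv\<^bsub>?Z\<^esub> a = ?b"
      by (rule Z.inv_equality[OF _ in_carrier[OF a] in_carrier[OF b]])
        (simp add: cocycle_group_def f coboundary_minus)
    then show "inv\<^bsub>?Z\<^esub> a \<in> ?B" using b by simp
  next
    fix a b assume "a \<in> ?B" "b \<in> ?B"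
    then obtain f g where
      "f \<in> cochains X (i - 1)" "a = coboundary X (i - 1) f"
      "g \<in> cochains X (i - 1)" "b = coboundary X (i - 1) g"
      by (auto simp: coboundaries_def)
    then show "a \<otimes>\<^bsub>?Z\<^esub> b \<in> ?B"
      unfolding coboundaries_def
      by (intro image_eqI[of _ _ "\<lambda>\<sigma>. f \<sigma> + g \<sigma>"])
        (auto simp: cocycle_group_def coboundary_add cochains_def)
  qed
  then show ?thesis using Z.normal_iff_subgroup by blast
qed

lemma group_reduced_cohomology_clique_complex:
  "group (reduced_cohomology K i (clique_complex G))"
  unfolding reduced_cohomology_def
  by (rule normal.factorgroup_is_group[OF coboundaries_normal]) (rule clique_complex_subset)

end

theory Submission
  imports Defs "HOL-Real_Asymp.Real_Asymp"
begin

text \<open>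
  Deleting the common neighbours of an edge turns its indicator into a nontrivial cocycle, so
  \<open>\<kappa>\<^sup>1 \<le> \<delta>\<^sup>1\<close> as soon as every edge lies on a 4-cycle that remains. For the converse,
  suppose fewer than \<open>\<delta>\<^sup>1\<close> vertices are deleted. With high probability all codegrees are close to
  \<open>n p\<^sup>2\<close>, and almost all of the common neighbours of a pair miss any given third vertex; hence
  at most one pair of remaining vertices has few remaining common neighbours. Fix a vertex \<open>v\<close>
  outside that pair. Since any two disjoint sets of about \<open>n\<^sup>1\<^sup>/\<^sup>4\<close> vertices span an edge, the sum
  of a cocycle along the 2-paths from \<open>v\<close> to \<open>u\<close> is the same for almost all of them, and this
  majority value \<open>g u\<close> satisfies \<open>f {u, w} = g u + g w\<close> on every edge: first on edges with many
  common neighbours with \<open>v\<close>, then on any edge through a suitable triangle. The random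
  properties follow from Hoeffding's inequality and union bounds, which need \<open>n p\<^sup>4\<close> to grow
  polynomially.
\<close>

section \<open>First cohomology of clique complexes over the two-element field\<close>

text \<open>A factor group is trivial exactly when every coset is the subgroup itself, so the
  question becomes one about individual cochains.\<close>

lemma trivial_reduced_cohomology_iff:
  fixes X :: "'v::linorder set set"
  assumes "\<And>\<sigma> \<tau>. \<sigma> \<in> X \<Longrightarrow> \<tau> \<subseteq> \<sigma> \<Longrightarrow> \<tau> \<in> X"
  shows "trivial_group (reduced_cohomology TYPE('k::field) i X) \<longleftrightarrow>
    (\<forall>f \<in> cochains X i. coboundary X i f = (\<lambda>_. 0) \<longrightarrow>
      (\<exists>g :: 'v set \<Rightarrow> 'k. g \<in> cochains X (i - 1) \<and> f = coboundary X (i - 1) g))"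
proof -
  let ?Z = "cocycle_group X i :: ('v set \<Rightarrow> 'k) monoid"
  let ?B = "coboundaries X i :: ('v set \<Rightarrow> 'k) set"
  interpret N: normal ?B ?Z by (rule coboundaries_normal) (rule assms)
  have grp: "group (?Z Mod ?B)" by (rule N.factorgroup_is_group)
  have "trivial_group (?Z Mod ?B) \<longleftrightarrow> carrier (?Z Mod ?B) \<subseteq> {?B}"
    using group.trivial_group_subset[OF grp] by simp
  also have "\<dots> \<longleftrightarrow> (\<forall>f \<in> carrier ?Z. ?B #>\<^bsub>?Z\<^esub> f = ?B)"
    by (auto simp: carrier_FactGroup)
  also have "\<dots> \<longleftrightarrow> (\<forall>f \<in> carrier ?Z. f \<in> ?B)"
    using N.coset_join1[OF _ _ N.subgroup_axioms] N.coset_join2[OF _ N.subgroup_axioms] by blast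
  finally show ?thesis
    unfolding reduced_cohomology_def by (auto simp: cocycle_group_def coboundaries_def)
qed

text \<open>Orientation signs disappear since -1 = 1 in \<open>bit\<close>.\<close>

lemma coboundary_bit:
  "coboundary X i (f :: 'v::linorder set \<Rightarrow> bit) \<sigma> =
     (if \<sigma> \<in> simplices X (i + 1) then \<Sum>v\<in>\<sigma>. f (\<sigma> - {v}) else 0)"
proof -
  have "(-1 :: bit) ^ k = 1" for k by (induction k) auto
  then show ?thesis by (simp only: coboundary_def mult_1_left)
qed

section \<open>Simplices of dimension at most two in a clique complex\<close>

lemma edge_neq: "finite_simple_graph G \<Longrightarrow> {x, y} \<in> edges G \<Longrightarrow> x \<noteq> y"
  by (force simp: finite_simple_graph_def)

lemma edge_verts: "finite_simple_graph G \<Longrightarrow> {x, y} \<in> edges G \<Longrightarrow> x \<in> verts G \<and> y \<in> verts G"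
  by (force simp: finite_simple_graph_def)

lemma simplices_clique_complex_0: "simplices (clique_complex G) 0 = (\<lambda>v. {v}) ` verts G"
  by (auto simp: simplices_def clique_complex_def card_1_singleton_iff)

lemma simplices_clique_complex_1:
  assumes "finite_simple_graph G"
  shows "simplices (clique_complex G) 1 = edges G"
proof (intro equalityI subsetI)
  fix e assume "e \<in> simplices (clique_complex G) 1"
  then have e: "card e = 2" "\<forall>u\<in>e. \<forall>v\<in>e. u \<noteq> v \<longrightarrow> {u, v} \<in> edges G"
    by (auto simp: simplices_def clique_complex_def)
  from e(1) obtain x y where "e = {x, y}" "x \<noteq> y" by (auto simp: card_2_iff)
  with e(2) show "e \<in> edges G" by auto
next
  fix e assume e: "e \<in> edges G"
  with assms have "card e = 2" "e \<subseteq> verts G" by (auto simp: finite_simple_graph_def)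
  moreover from this(1) obtain x y where "e = {x, y}" "x \<noteq> y" by (auto simp: card_2_iff)
  ultimately show "e \<in> simplices (clique_complex G) 1"
    using e by (auto simp: simplices_def clique_complex_def insert_commute)
qed

lemma simplices_clique_complex_2:
  assumes "finite_simple_graph G"
  shows "\<sigma> \<in> simplices (clique_complex G) 2 \<longleftrightarrow>
    (\<exists>x y z. \<sigma> = {x, y, z} \<and> {x, y} \<in> edges G \<and> {y, z} \<in> edges G \<and> {x, z} \<in> edges G)"
proof
  assume "\<sigma> \<in> simplices (clique_complex G) 2"
  then have s: "card \<sigma> = 3" "\<forall>u\<in>\<sigma>. \<forall>v\<in>\<sigma>. u \<noteq> v \<longrightarrow> {u, v} \<in> edges G"
    by (auto simp: simplices_def clique_complex_def)
  from s(1) obtain x y z where "\<sigma> = {x, y, z}" "x \<noteq> y" "y \<noteq> z" "x \<noteq> z"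
    by (auto simp: card_3_iff)
  with s(2) show "\<exists>x y z. \<sigma> = {x, y, z} \<and> {x, y} \<in> edges G \<and> {y, z} \<in> edges G \<and> {x, z} \<in> edges G"
    by blast
next
  assume "\<exists>x y z. \<sigma> = {x, y, z} \<and> {x, y} \<in> edges G \<and> {y, z} \<in> edges G \<and> {x, z} \<in> edges G"
  then obtain x y z where
    s: "\<sigma> = {x, y, z}" "{x, y} \<in> edges G" "{y, z} \<in> edges G" "{x, z} \<in> edges G"
    by blast
  from s(2-4) have "x \<noteq> y" "y \<noteq> z" "x \<noteq> z" "x \<in> verts G" "y \<in> verts G" "z \<in> verts G"
    using edge_neq[OF assms] edge_verts[OF assms] by blast+
  with s show "\<sigma> \<in> simplices (clique_complex G) 2"
    by (auto simp: simplices_def clique_complex_def insert_commute)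
qed

text \<open>Values of \<open>f\<close> off the edges enter neither condition, so \<open>f\<close>
  may be an arbitrary function on vertex sets and the 0-cochain an arbitrary function on
  vertices.\<close>

lemma trivial_cohomology_1_bit_iff:
  fixes G :: "'v::linorder sgraph"
  assumes G: "finite_simple_graph G"
  shows "trivial_group (reduced_cohomology TYPE(bit) 1 (clique_complex G)) \<longleftrightarrow>
    (\<forall>f :: 'v set \<Rightarrow> bit.
      (\<forall>x y z. {x, y} \<in> edges G \<longrightarrow> {y, z} \<in> edges G \<longrightarrow> {x, z} \<in> edges G \<longrightarrow>
        f {x, y} = f {x, z} + f {y, z}) \<longrightarrow>
      (\<exists>g. \<forall>x y. {x, y} \<in> edges G \<longrightarrow> f {x, y} = g x + g y))" (is "?L = (\<forall>f. ?C f \<longrightarrow> ?D f)")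
proof -
  let ?X = "clique_complex G"
  have cocycle: "coboundary ?X 1 f = (\<lambda>_. 0) \<longleftrightarrow> ?C f" for f :: "'v set \<Rightarrow> bit"
  proof -
    have tri: "coboundary ?X 1 f {x, y, z} = f {x, y} + f {x, z} + f {y, z}"
      if "{x, y} \<in> edges G" "{y, z} \<in> edges G" "{x, z} \<in> edges G" for x y z
    proof -
      have "{x, y, z} \<in> simplices ?X 2"
        using that unfolding simplices_clique_complex_2[OF G] by blast
      then have "coboundary ?X 1 f {x, y, z} = (\<Sum>v\<in>{x, y, z}. f ({x, y, z} - {v}))"
        by (simp only: coboundary_bit) simp
      moreover have "x \<noteq> y" "y \<noteq> z" "x \<noteq> z" using that edge_neq[OF G] by blast+
      moreover from this have "{x, y, z} - {x} = {y, z}" "{x, y, z} - {y} = {x, z}"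
        "{x, y, z} - {z} = {x, y}" by auto
      ultimately show ?thesis
        by (simp add: add_ac del: add_bit_eq_xor)
    qed
    have bit3: "a + b + c = 0 \<longleftrightarrow> a = b + c" for a b c :: bit
      by (cases "a = 0"; cases "b = 0"; cases "c = 0") simp_all
    show ?thesis
    proof
      assume f0: "coboundary ?X 1 f = (\<lambda>_. 0)"
      show "?C f"
      proof (intro allI impI)
        fix x y z assume "{x, y} \<in> edges G" "{y, z} \<in> edges G" "{x, z} \<in> edges G"
        from tri[OF this] have "f {x, y} + f {x, z} + f {y, z} = 0"
          by (simp only: f0)
        then show "f {x, y} = f {x, z} + f {y, z}" by (simp only: bit3)
      qed
    next
      assume C: "?C f"
      show "coboundary ?X 1 f = (\<lambda>_. 0)"
      proof
        fix \<sigma> show "coboundary ?X 1 f \<sigma> = 0"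
        proof (cases "\<sigma> \<in> simplices ?X 2")
          case True
          then obtain x y z where "\<sigma> = {x, y, z}" "{x, y} \<in> edges G" "{y, z} \<in> edges G"
            "{x, z} \<in> edges G" unfolding simplices_clique_complex_2[OF G] by blast
          then have "coboundary ?X 1 f \<sigma> = f {x, y} + f {x, z} + f {y, z}"
            "f {x, y} = f {x, z} + f {y, z}" using C tri by blast+
          then show ?thesis by (simp only: bit3)
        qed (simp add: coboundary_bit)
      qed
    qed
  qed
  have edge: "coboundary ?X 0 h {x, y} = h {x} + h {y}" if "{x, y} \<in> edges G"
    for h :: "'v set \<Rightarrow> bit" and x y
  proof -
    have "{x, y} \<in> simplices ?X 1" using that simplices_clique_complex_1[OF G] by blast
    moreover have "x \<noteq> y" using that edge_neq[OF G] by blast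
    moreover from this have "{x, y} - {x} = {y}" "{x, y} - {y} = {x}" by auto
    ultimately show ?thesis by (simp add: coboundary_bit add_ac del: add_bit_eq_xor)
  qed
  have "?L \<longleftrightarrow> (\<forall>f :: 'v set \<Rightarrow> bit. f \<in> cochains ?X 1 \<longrightarrow> ?C f \<longrightarrow>
      (\<exists>g. g \<in> cochains ?X 0 \<and> f = coboundary ?X 0 g))"
    by (subst trivial_reduced_cohomology_iff[OF clique_complex_subset])
      (simp_all only: Ball_def cocycle diff_self)
  also have "\<dots> \<longleftrightarrow> (\<forall>f. ?C f \<longrightarrow> ?D f)"
  proof (intro iffI allI impI)
    fix f :: "'v set \<Rightarrow> bit"
    assume *: "\<forall>f :: 'v set \<Rightarrow> bit. f \<in> cochains ?X 1 \<longrightarrow> ?C f \<longrightarrow>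
      (\<exists>g. g \<in> cochains ?X 0 \<and> f = coboundary ?X 0 g)" and C: "?C f"
    \<comment> \<open>Truncation to the edges gives a genuine 1-cochain and keeps the condition on
      triangles.\<close>
    let ?f = "\<lambda>e. if e \<in> edges G then f e else 0"
    have "?f \<in> cochains ?X 1" by (simp add: cochains_def simplices_clique_complex_1[OF G])
    moreover have "?C ?f" using C by auto
    ultimately obtain g where g: "?f = coboundary ?X 0 g" using * by blast
    show "?D f"
    proof (intro exI allI impI)
      fix x y assume "{x, y} \<in> edges G"
      then show "f {x, y} = g {x} + g {y}" using edge[of x y g] fun_cong[OF g, of "{x, y}"] by (simp del: add_bit_eq_xor)
    qed
  next
    fix f :: "'v set \<Rightarrow> bit"
    assume *: "\<forall>f. ?C f \<longrightarrow> ?D f" and f: "f \<in> cochains ?X 1" and C: "?C f"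
    obtain g where g: "\<And>x y. {x, y} \<in> edges G \<Longrightarrow> f {x, y} = g x + g y" using * C by blast
    let ?h = "\<lambda>\<sigma>. if \<sigma> \<in> simplices ?X 0 then g (the_elem \<sigma>) else 0"
    have "f \<sigma> = coboundary ?X 0 ?h \<sigma>" for \<sigma>
    proof (cases "\<sigma> \<in> edges G")
      case True
      then have "card \<sigma> = 2" using G by (simp add: finite_simple_graph_def)
      then obtain x y where xy: "\<sigma> = {x, y}" by (auto simp: card_2_iff)
      with True have "x \<in> verts G" "y \<in> verts G" using edge_verts[OF G] by blast+
      with True xy show ?thesis
        by (simp add: edge g simplices_clique_complex_0 del: add_bit_eq_xor)
    next
      case False
      then show ?thesis using f
        by (simp add: coboundary_bit cochains_def simplices_clique_complex_1[OF G])
    qed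
    then show "\<exists>g. g \<in> cochains ?X 0 \<and> f = coboundary ?X 0 g"
      by (intro exI[of _ ?h]) (auto simp: cochains_def)
  qed
  finally show ?thesis .
qed

section \<open>Pseudorandom graphs\<close>

lemma bit_add_cancel: "a + b + (b + c) = a + c" for a b c :: bit
  by (cases "a = 0"; cases "b = 0"; cases "c = 0") simp_all

lemma ex_mem_finite_not_mem:
  assumes "finite B" "card B < card A"
  shows "\<exists>x\<in>A. x \<notin> B"
  using assms card_mono[of B A] by (metis leD subsetI)

text \<open>The reals \<open>m\<close> and \<open>M\<close> bound codegrees from below and above;
  the lower bound holds even after discarding one further vertex and its neighbours. In
  \<open>codegree_gap\<close>, twice \<open>m\<close> exceeds what fits into fewer than
  \<open>M\<close> deleted vertices together with two sets of fewer than
  \<open>2 * s ^ 2 + 2 * s + 1\<close> vertices. By \<open>M_le\<close>, more than three vertices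
  survive a deletion of fewer than \<open>M\<close>.\<close>

locale pseudorandom_graph =
  fixes G :: "'v::linorder sgraph" and s :: nat and m M :: real
  assumes simple: "finite_simple_graph G"
    and edge_between: "\<And>A B. A \<subseteq> verts G \<Longrightarrow> B \<subseteq> verts G \<Longrightarrow> A \<inter> B = {} \<Longrightarrow>
      s \<le> card A \<Longrightarrow> s \<le> card B \<Longrightarrow> \<exists>a\<in>A. \<exists>b\<in>B. {a, b} \<in> edges G"
    and codegree_le: "\<And>c d. c \<in> verts G \<Longrightarrow> d \<in> verts G \<Longrightarrow> c \<noteq> d \<Longrightarrow>
      real (card (nbrs G c \<inter> nbrs G d)) \<le> M"
    and le_codegree_Diff: "\<And>a c d. a \<in> verts G \<Longrightarrow> c \<in> verts G \<Longrightarrow> d \<in> verts G \<Longrightarrow>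
      a \<noteq> c \<Longrightarrow> a \<noteq> d \<Longrightarrow> c \<noteq> d \<Longrightarrow> m \<le> real (card (nbrs G c \<inter> nbrs G d - nbrs G a - {a}))"
    and M_nonneg: "0 \<le> M"
    and codegree_gap: "M + 4 * real s ^ 2 + 4 * real s + 2 \<le> 2 * m"
    and M_le: "M + 3 \<le> real (card (verts G))"
begin

section \<open>Neighbourhoods and codegrees in a pseudorandom graph\<close>

lemma finite_verts: "finite (verts G)"
  using simple by (simp add: finite_simple_graph_def)

lemma nbrs_subset: "nbrs G x \<subseteq> verts G"
  using edge_verts[OF simple] by (auto simp: nbrs_def)

lemma finite_nbrs: "finite (nbrs G x)"
  using nbrs_subset finite_verts by (rule finite_subset)

lemma nbrs_sym: "x \<in> nbrs G y \<longleftrightarrow> y \<in> nbrs G x"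
  by (simp add: nbrs_def insert_commute)

lemma not_self_nbr: "x \<notin> nbrs G x"
  using edge_neq[OF simple, of x x] by (auto simp: nbrs_def)

lemma edge_iff: "{x, y} \<in> edges G \<longleftrightarrow> x \<in> nbrs G y"
  by (simp add: nbrs_def)

lemma edges_delete_verts_iff:
  "{x, y} \<in> edges (delete_verts G C) \<longleftrightarrow> x \<in> nbrs G y \<and> x \<notin> C \<and> y \<notin> C"
  using edge_verts[OF simple] by (auto simp: delete_verts_def edge_iff)

lemma ex_third_vertex: "\<exists>z\<in>verts G. z \<noteq> x \<and> z \<noteq> y"
proof -
  have "card {x, y} \<le> 2" by (cases "x = y") auto
  moreover have "3 \<le> card (verts G)" using M_le M_nonneg by linarith
  ultimately show ?thesis using ex_mem_finite_not_mem[of "{x, y}" "verts G"] by auto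
qed

lemma le_codegree:
  assumes "c \<in> verts G" "d \<in> verts G" "c \<noteq> d"
  shows "m \<le> real (card (nbrs G c \<inter> nbrs G d))"
proof -
  obtain a where "a \<in> verts G" "a \<noteq> c" "a \<noteq> d" using ex_third_vertex by blast
  then have "m \<le> real (card (nbrs G c \<inter> nbrs G d - nbrs G a - {a}))"
    using assms by (intro le_codegree_Diff)
  also have "\<dots> \<le> real (card (nbrs G c \<inter> nbrs G d))"
    using finite_nbrs by (intro of_nat_mono card_mono) auto
  finally show ?thesis .
qed

text \<open>Supplies the two sets between which a 4-cycle through an edge is closed. The gap
  inequality forces \<open>s\<close> below \<open>m\<close>, and common neighbours with a third
  vertex already suffice.\<close>

lemma s_le_nbrs_Diff:
  assumes "a \<in> verts G" "b \<in> verts G" "a \<noteq> b"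
  shows "s \<le> card (nbrs G b - nbrs G a - {a})"
proof -
  obtain d where "d \<in> verts G" "d \<noteq> a" "d \<noteq> b" using ex_third_vertex by blast
  then have "m \<le> real (card (nbrs G b \<inter> nbrs G d - nbrs G a - {a}))"
    using assms by (intro le_codegree_Diff) auto
  also have "\<dots> \<le> real (card (nbrs G b - nbrs G a - {a}))"
    using finite_nbrs by (intro of_nat_mono card_mono) auto
  finally show ?thesis using codegree_gap M_nonneg zero_le_power2[of "real s"] by linarith
qed

text \<open>
  The indicator of an edge without common neighbours is a cocycle; it is not a coboundary because
  the edge lies on an induced 4-cycle.
\<close>
lemma nontrivial_delete_common_nbrs:
  assumes ab: "{a, b} \<in> edges G"
  shows "\<not> trivial_group (reduced_cohomology TYPE(bit) 1
    (clique_complex (delete_verts G (common_nbrs G {a, b}))))"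
proof
  let ?C = "nbrs G a \<inter> nbrs G b"
  let ?H = "delete_verts G ?C"
  define f :: "'v set \<Rightarrow> bit" where "f e = (if e = {a, b} then 1 else 0)" for e
  assume "trivial_group (reduced_cohomology TYPE(bit) 1
    (clique_complex (delete_verts G (common_nbrs G {a, b}))))"
  then have triv: "trivial_group (reduced_cohomology TYPE(bit) 1 (clique_complex ?H))"
    by (simp add: common_nbrs_def)
  have a_b: "a \<noteq> b" "a \<in> verts G" "b \<in> verts G"
    using edge_neq[OF simple] edge_verts[OF simple] ab by blast+
  have zero: "f {x, y} = 0" if "{x, y} \<in> edges ?H" "{y, z} \<in> edges ?H" "{x, z} \<in> edges ?H" for x y z
  proof -
    have "{x, y} \<noteq> {a, b}"
    \<comment> \<open>The third vertex of a triangle on \<open>{a, b}\<close> would be a deleted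
      common neighbour.\<close>
    proof
      assume "{x, y} = {a, b}"
      with that have "z \<in> ?C" by (auto simp: edges_delete_verts_iff doubleton_eq_iff nbrs_sym)
      with that show False by (simp add: edges_delete_verts_iff)
    qed
    then show ?thesis by (simp add: f_def)
  qed
  have "\<exists>g. \<forall>x y. {x, y} \<in> edges ?H \<longrightarrow> f {x, y} = g x + g y"
    using triv[unfolded trivial_cohomology_1_bit_iff[OF finite_simple_graph_delete_verts[OF simple]]]
  proof (rule allE[where x = f], elim mp, intro allI impI)
    fix x y z assume e: "{x, y} \<in> edges ?H" "{y, z} \<in> edges ?H" "{x, z} \<in> edges ?H"
    have "f {x, y} = 0" "f {x, z} = 0" "f {y, z} = 0"
      using e zero[of x y z] zero[of x z y] zero[of y z x] by (simp_all add: insert_commute)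
    then show "f {x, y} = f {x, z} + f {y, z}" by simp
  qed
  then obtain g where g: "\<And>x y. {x, y} \<in> edges ?H \<Longrightarrow> f {x, y} = g x + g y" by blast
  \<comment> \<open>Each of \<open>x\<close> and \<open>y\<close> misses one of the two
    neighbourhoods, so both survive the deletion, and a, x, y, b is an induced 4-cycle.\<close>
  obtain x y where
    x: "x \<in> nbrs G a - nbrs G b - {b}" and y: "y \<in> nbrs G b - nbrs G a - {a}" and "{x, y} \<in> edges G"
    using edge_between[of "nbrs G a - nbrs G b - {b}" "nbrs G b - nbrs G a - {a}"]
      s_le_nbrs_Diff[of a b] s_le_nbrs_Diff[of b a] a_b nbrs_subset by blast
  then have e: "{a, x} \<in> edges ?H" "{x, y} \<in> edges ?H" "{y, b} \<in> edges ?H" "{a, b} \<in> edges ?H"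
    using ab not_self_nbr by (auto simp: edges_delete_verts_iff edge_iff nbrs_sym)
  have "f {a, x} = 0" "f {x, y} = 0" "f {y, b} = 0" "f {a, b} = 1"
    using x y not_self_nbr by (auto simp: f_def doubleton_eq_iff)
  \<comment> \<open>Along the path a, x, y, b the sums of \<open>g\<close> telescope to
    \<open>g a + g b\<close>, which is 1, whereas the three edge values are 0.\<close>
  moreover have "g a + g x + (g x + g b) = f {a, b}" "g x + g y + (g y + g b) = g x + g b"
    using g[OF e(4)] by (simp_all only: bit_add_cancel)
  ultimately have "(0 :: bit) + (0 + 0) = 1"
    using g[OF e(1)] g[OF e(2)] g[OF e(3)] by (simp only:)
  then show False by simp
qed

text \<open>The hypothesis on \<open>card C\<close> serves twice: it gives
  \<open>card C < M\<close>, so that two different pairs cannot both be bad, and it leaves a common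
  neighbour to every edge, including an edge whose ends form the bad pair.\<close>

lemma trivial_delete_verts:
  assumes C: "C \<subseteq> verts G"
    and card_C: "\<And>a b. {a, b} \<in> edges G \<Longrightarrow> card C < card (common_nbrs G {a, b})"
  shows "trivial_group (reduced_cohomology TYPE(bit) 1 (clique_complex (delete_verts G C)))"
proof -
  define V where "V = verts G - C"
  define N where "N x y = nbrs G x \<inter> nbrs G y - C" for x y
  text \<open>
    A pair is bad if it has fewer than \<open>T\<close> common neighbours left. The value of \<open>T\<close> leaves \<open>s\<close>
    vertices after removing \<open>s\<close> vertices and \<open>s\<close> sets of size below \<open>2 * s\<close>.
  \<close>
  define T where "T = 2 * s ^ 2 + 2 * s + 1"
  let ?H = "delete_verts G C"
  have V: "finite V" "V \<subseteq> verts G" using finite_verts by (auto simp: V_def)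
  have finC: "finite C" using C finite_verts finite_subset by blast
  have N_V: "N x y \<subseteq> V" for x y using nbrs_subset by (auto simp: N_def V_def)
  have finN: "finite (N x y)" for x y using N_V V(1) by (rule finite_subset)
  have N_commute: "N x y = N y x" for x y by (auto simp: N_def)
  have self_N: "x \<notin> N x y" "y \<notin> N x y" for x y using not_self_nbr by (auto simp: N_def)
  have edge_H: "{x, y} \<in> edges ?H \<longleftrightarrow> x \<in> V \<and> y \<in> V \<and> x \<in> nbrs G y" for x y
    using nbrs_subset nbrs_sym by (auto simp: edges_delete_verts_iff V_def)

  have "real (card C) < M"
  proof -
    obtain c where c: "c \<in> verts G" using ex_third_vertex by blast
    obtain d where d: "d \<in> verts G" "d \<noteq> c" using ex_third_vertex by blast
    \<comment> \<open>Positive codegrees provide an edge, and \<open>C\<close> is smaller than its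
      codegree.\<close>
    have "0 < m" using codegree_gap M_nonneg zero_le_power2[of "real s"] by linarith
    then have "nbrs G c \<inter> nbrs G d \<noteq> {}" using le_codegree[OF c d(1)] d(2) by auto
    then obtain x where "{x, c} \<in> edges G" by (auto simp: edge_iff)
    then have "card C < card (nbrs G x \<inter> nbrs G c)" "real (card (nbrs G x \<inter> nbrs G c)) \<le> M"
      using card_C[of x c] codegree_le edge_verts[OF simple] edge_neq[OF simple]
      by (auto simp: common_nbrs_def)
    then show ?thesis by linarith
  qed
  have "3 < card V"
    using \<open>real (card C) < M\<close> M_le card_Diff_subset[OF finC C] by (simp add: V_def)

  have disjoint_bad: False
    if uvwz: "u \<in> V" "v \<in> V" "w \<in> V" "z \<in> V" "u \<noteq> v" "w \<noteq> z" "w \<noteq> u" "w \<noteq> v"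
      and bad: "card (N u v) < T" "card (N w z) < T" for u v w z
  proof -
    \<comment> \<open>Discarding the neighbours of \<open>w\<close> makes \<open>?A\<close> disjoint
      from \<open>?B\<close>, so the two lower bounds add up even when \<open>z\<close> is
      \<open>u\<close> or \<open>v\<close>.\<close>
    let ?A = "nbrs G u \<inter> nbrs G v - nbrs G w - {w}" and ?B = "nbrs G w \<inter> nbrs G z"
    have "m \<le> real (card ?A)" using uvwz V(2) by (intro le_codegree_Diff) auto
    moreover have "m \<le> real (card ?B)" using uvwz V(2) by (intro le_codegree) auto
    moreover have "card ?A + card ?B = card (?A \<union> ?B)"
      using finite_nbrs by (intro card_Un_disjoint[symmetric]) auto
    moreover have "card (?A \<union> ?B) \<le> card (N u v \<union> N w z \<union> C)"
      using finN finC by (intro card_mono) (auto simp: N_def)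
    moreover have "\<dots> \<le> card (N u v) + card (N w z) + card C"
      by (meson add_le_mono card_Un_le le_refl order_trans)
    ultimately have "2 * m \<le> real (card (N u v)) + real (card (N w z)) + real (card C)"
      by linarith
    moreover have "real (card (N u v)) \<le> real T - 1" "real (card (N w z)) \<le> real T - 1"
      using bad by linarith+
    ultimately have "2 * m < 2 * real T - 2 + M" using \<open>real (card C) < M\<close> by linarith
    then show False using codegree_gap by (simp add: T_def)
  qed
  have bad_unique: "{u, v} = {w, z}"
    if "u \<in> V" "v \<in> V" "w \<in> V" "z \<in> V" "u \<noteq> v" "w \<noteq> z" "card (N u v) < T" "card (N w z) < T" for u v w z
  proof (rule ccontr)
    assume "{u, v} \<noteq> {w, z}"
    then have "w \<notin> {u, v} \<or> z \<notin> {u, v}" using that by auto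
    then show False
      using disjoint_bad[of u v w z] disjoint_bad[of u v z w] that N_commute[of w z] by auto
  qed

  have "\<exists>v\<in>V. \<forall>u\<in>V. u \<noteq> v \<longrightarrow> T \<le> card (N u v)"
  proof (cases "\<exists>u\<in>V. \<exists>w\<in>V. u \<noteq> w \<and> card (N u w) < T")
    case True
    then obtain u w where uw: "u \<in> V" "w \<in> V" "u \<noteq> w" "card (N u w) < T" by blast
    have "card {u, w} < card V" using \<open>3 < card V\<close> uw(3) by simp
    then obtain v where v: "v \<in> V" "v \<notin> {u, w}" using ex_mem_finite_not_mem[of "{u, w}" V] by auto
    then have "T \<le> card (N x v)" if "x \<in> V" "x \<noteq> v" for x
      using bad_unique[of u w x v] uw that by (auto simp: doubleton_eq_iff not_less[symmetric])
    with v show ?thesis by blast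
  next
    case False
    moreover have "V \<noteq> {}" using \<open>3 < card V\<close> by auto
    ultimately show ?thesis by (meson all_not_in_conv not_less)
  qed
  then obtain v where v: "v \<in> V" and N_v: "\<And>u. u \<in> V \<Longrightarrow> u \<noteq> v \<Longrightarrow> T \<le> card (N u v)" by blast

  show ?thesis
    unfolding trivial_cohomology_1_bit_iff[OF finite_simple_graph_delete_verts[OF simple]]
  proof (intro allI impI)
    fix f :: "'v set \<Rightarrow> bit"
    assume "\<forall>x y z. {x, y} \<in> edges ?H \<longrightarrow> {y, z} \<in> edges ?H \<longrightarrow> {x, z} \<in> edges ?H \<longrightarrow>
      f {x, y} = f {x, z} + f {y, z}"
    then have cocycle: "f {x, y} = f {x, z} + f {z, y}"
      if "x \<in> V" "y \<in> V" "x \<in> nbrs G y" "z \<in> N x y" for x y z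
      using that N_V[of x y] unfolding edge_H
      by (simp add: N_def nbrs_sym insert_commute subset_iff)

    text \<open>
      All but few of the 2-paths from \<^term>\<open>v\<close> to \<^term>\<open>u\<close> agree on the sum of \<^term>\<open>f\<close>, and
      this majority value is the 0-cochain \<^term>\<open>g\<close> that bounds \<^term>\<open>f\<close>.
    \<close>
    define h where "h u x = f {v, x} + f {x, u}" for u x
    define g :: "'v \<Rightarrow> bit" where "g u = (if u = v \<or> card {x \<in> N u v. h u x \<noteq> 0} < s then 0 else 1)" for u
    have minority: "card {x \<in> N u v. h u x \<noteq> g u} < s" if u: "u \<in> V" "u \<noteq> v" for u
    proof (rule ccontr)
      let ?A = "{x \<in> N u v. h u x \<noteq> 0}" and ?B = "{x \<in> N u v. h u x \<noteq> 1}"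
      assume "\<not> ?thesis"
      \<comment> \<open>The value \<open>g u = 0\<close> is only chosen when its minority is small,
        so \<open>g u = 1\<close> remains, and then both classes are large.\<close>
      then have "s \<le> card ?A" "s \<le> card ?B" using u by (auto simp: g_def split: if_splits)
      moreover have "?A \<inter> ?B = {}" by auto
      ultimately obtain x y where xy: "x \<in> ?A" "y \<in> ?B" "{x, y} \<in> edges G"
        using edge_between[of ?A ?B] N_V V(2) by blast
      then have "y \<in> V" using N_V by blast
      \<comment> \<open>The edge \<open>{x, y}\<close> forms triangles with \<open>v\<close> and
        with \<open>u\<close>; adding the two cocycle equations cancels \<open>f {x, y}\<close>, so
        the two 2-paths have equal sums.\<close>
      have "x \<in> N v y" "x \<in> N y u" "v \<in> nbrs G y" "y \<in> nbrs G u"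
        using xy by (auto simp: N_def edge_iff nbrs_sym)
      then have "f {v, y} = f {v, x} + f {x, y}" "f {y, u} = f {x, y} + f {x, u}"
        using cocycle[of v y x] cocycle[of y u x] v u(1) \<open>y \<in> V\<close> insert_commute[of y x "{}"]
        by metis+
      then have "h u y = f {v, x} + f {x, y} + (f {x, y} + f {x, u})"
        by (simp only: h_def)
      then have "h u y = h u x" by (simp only: bit_add_cancel h_def)
      with xy show False by simp
    qed
    have edge_v: "f {v, u} = g u" if u: "u \<in> V" "v \<in> nbrs G u" for u
    proof -
      have "u \<noteq> v" using u not_self_nbr by auto
      \<comment> \<open>As \<open>s < T\<close>, some 2-path carries the majority value, and it
        closes to a triangle with the edge \<open>{v, u}\<close>.\<close>
      have "card {x \<in> N u v. h u x \<noteq> g u} < card (N u v)"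
        using minority[OF u(1) \<open>u \<noteq> v\<close>] N_v[OF u(1) \<open>u \<noteq> v\<close>] by (simp add: T_def)
      then obtain x where x: "x \<in> N u v" "h u x = g u"
        using ex_mem_finite_not_mem[of "{x \<in> N u v. h u x \<noteq> g u}" "N u v"] finN by auto
      then show ?thesis using cocycle[of v u x] u v N_commute[of u v] by (simp only: h_def)
    qed
    have edge_common: "f {u, w} = g u + g w"
      if u: "u \<in> V" "u \<noteq> v" and w: "w \<in> V" "w \<noteq> v" and uw: "u \<in> nbrs G w"
        and large: "2 * s \<le> card (N u v \<inter> nbrs G w)" for u w
    proof -
      \<comment> \<open>Fewer than \<open>2 * s\<close> vertices are in a minority for
        \<open>u\<close> or for \<open>w\<close>, so some common neighbour \<open>x\<close> of
        \<open>u\<close>, \<open>v\<close>, \<open>w\<close> is in neither. In the triangle on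
        \<open>u\<close>, \<open>w\<close>, \<open>x\<close> the term \<open>f {v, x}\<close> may be
        added twice.\<close>
      let ?A = "{x \<in> N u v. h u x \<noteq> g u}" and ?B = "{x \<in> N w v. h w x \<noteq> g w}"
      have "card (?A \<union> ?B) < card (N u v \<inter> nbrs G w)"
        using card_Un_le[of ?A ?B] minority[OF u] minority[OF w] large by linarith
      then obtain x where x: "x \<in> N u v \<inter> nbrs G w" "x \<notin> ?A \<union> ?B"
        using ex_mem_finite_not_mem[of "?A \<union> ?B" "N u v \<inter> nbrs G w"] finN by auto
      then have h: "h u x = g u" "h w x = g w" and "x \<in> N u w" by (auto simp: N_def)
      then have "f {u, w} = f {u, x} + f {x, w}" using cocycle u w uw by blast
      also have "\<dots> = f {u, x} + f {v, x} + (f {v, x} + f {x, w})" by (simp only: bit_add_cancel)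
      also have "\<dots> = h u x + h w x" by (simp only: h_def insert_commute add.commute)
      finally show ?thesis by (simp only: h)
    qed
    have few_exceptions: "card {w \<in> V. card (N a v \<inter> nbrs G w) < 2 * s} < s"
      if a: "a \<in> V" "a \<noteq> v" for a
    proof (rule ccontr)
      let ?W = "{w \<in> V. card (N a v \<inter> nbrs G w) < 2 * s}"
      assume "\<not> card ?W < s"
      then obtain S where S: "S \<subseteq> ?W" "card S = s" "finite S"
        using obtain_subset_with_card_n[of s ?W] not_less by blast
      \<comment> \<open>Removing \<open>S\<close> as well makes the rest of \<open>N a v\<close>
        disjoint from \<open>S\<close>, as \<open>edge_between\<close> requires. No edge joins the
        two sets, yet at least \<open>s\<close> vertices remain.\<close>
      let ?U = "(\<Union>w\<in>S. N a v \<inter> nbrs G w) \<union> S"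
      have "card ?U \<le> card (\<Union>w\<in>S. N a v \<inter> nbrs G w) + card S" by (rule card_Un_le)
      also have "card (\<Union>w\<in>S. N a v \<inter> nbrs G w) \<le> (\<Sum>w\<in>S. card (N a v \<inter> nbrs G w))"
        by (rule card_UN_le[OF S(3)])
      also have "\<dots> \<le> (\<Sum>w\<in>S. 2 * s)" using S(1) by (intro sum_mono) auto
      finally have "card ?U \<le> 2 * s ^ 2 + s" using S(2) by (simp add: power2_eq_square)
      moreover have "card (N a v) - card ?U \<le> card (N a v - ?U)"
        using finN S(3) by (intro diff_card_le_card_Diff) auto
      ultimately have "s \<le> card (N a v - ?U)" using N_v[OF a] by (simp add: T_def)
      moreover have "S \<inter> (N a v - ?U) = {}" "S \<subseteq> verts G" "N a v - ?U \<subseteq> verts G"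
        using S(1) N_V V(2) by blast+
      moreover have "s \<le> card S" using S(2) by simp
      ultimately obtain x y where "x \<in> S" "y \<in> N a v - ?U" "{x, y} \<in> edges G"
        using edge_between[of S "N a v - ?U"] by blast
      then show False by (auto simp: edge_iff nbrs_sym)
    qed
    have edge_good: "f {a, b} = g a + g b"
      if a: "a \<in> V" "a \<noteq> v" and b: "b \<in> V" "b \<noteq> v" and ab: "a \<in> nbrs G b"
        and good: "T \<le> card (N a b)" for a b
    proof -
      \<comment> \<open>Fewer than \<open>2 * s\<close> vertices are excluded in total,
        \<open>v\<close> included, so a triangle on \<open>a\<close>, \<open>b\<close>,
        \<open>w\<close> exists whose other two sides are covered by
        \<open>edge_common\<close>.\<close>
      let ?W = "\<lambda>a. {w \<in> V. card (N a v \<inter> nbrs G w) < 2 * s}"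
      have "card (insert v (?W a \<union> ?W b)) \<le> Suc (card (?W a \<union> ?W b))"
        by (rule card_insert_le_m1) simp_all
      also have "card (?W a \<union> ?W b) \<le> card (?W a) + card (?W b)" by (rule card_Un_le)
      finally have "card (insert v (?W a \<union> ?W b)) < card (N a b)"
        using few_exceptions[OF a] few_exceptions[OF b] good by (simp add: T_def)
      then obtain w where w: "w \<in> N a b" "w \<notin> insert v (?W a \<union> ?W b)"
        using ex_mem_finite_not_mem[of "insert v (?W a \<union> ?W b)" "N a b"] V(1) by auto
      then have w': "w \<in> V" "w \<noteq> v" "a \<in> nbrs G w" "b \<in> nbrs G w"
        "2 * s \<le> card (N a v \<inter> nbrs G w)" "2 * s \<le> card (N b v \<inter> nbrs G w)"
        using N_V[of a b] by (auto simp: N_def nbrs_sym)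
      have "f {a, b} = f {a, w} + f {w, b}" using cocycle a b ab w(1) by blast
      also have "f {w, b} = f {b, w}" by (simp only: insert_commute)
      also have "f {a, w} + f {b, w} = g a + g w + (g b + g w)"
        using edge_common[OF a w'(1,2,3,5)] edge_common[OF b w'(1,2,4,6)] by (simp only:)
      also have "\<dots> = g a + g w + (g w + g b)" by (simp only: add.commute)
      finally show ?thesis by (simp only: bit_add_cancel)
    qed
    have edge_any: "f {a, b} = g a + g b"
      if a: "a \<in> V" "a \<noteq> v" and b: "b \<in> V" "b \<noteq> v" and ab: "a \<in> nbrs G b" for a b
    proof (cases "T \<le> card (N a b)")
      case False
      \<comment> \<open>The ends form the bad pair, but one common neighbour \<open>w\<close>
        survives. By uniqueness of the bad pair, the other two sides of the triangle are good, or
        they are edges at \<open>v\<close>.\<close>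
      have "{a, b} \<in> edges G" using ab by (simp add: edge_iff)
      then have "card C < card (nbrs G a \<inter> nbrs G b)" using card_C[of a b] by (simp add: common_nbrs_def)
      then obtain w where w: "w \<in> N a b"
        using ex_mem_finite_not_mem[OF finC] by (auto simp: N_def)
      then have w': "w \<in> V" "a \<in> nbrs G w" "b \<in> nbrs G w" "w \<noteq> a" "w \<noteq> b"
        using N_V[of a b] self_N by (auto simp: N_def nbrs_sym)
      have "a \<noteq> b" using ab not_self_nbr by auto
      have side: "f {c, w} = g c + g w" if c: "c \<in> {a, b}" for c
      proof (cases "w = v")
        case True
        then have "f {w, c} = g c" using edge_v[of c] c a b w' nbrs_sym by blast
        moreover have "g w = 0" using True by (simp add: g_def)
        ultimately show ?thesis by (simp only: insert_commute add_0_right)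
      next
        case False
        have "{a, b} \<noteq> {c, w}" using w' c by auto
        then have "T \<le> card (N c w)"
          using bad_unique[of a b c w] a b c w' \<open>a \<noteq> b\<close> \<open>\<not> T \<le> card (N a b)\<close> by auto
        then show ?thesis using edge_good[of c w] False a b c w' by blast
      qed
      have "f {a, b} = f {a, w} + f {w, b}" using cocycle a b ab w(1) by blast
      also have "f {w, b} = f {b, w}" by (simp only: insert_commute)
      also have "f {a, w} + f {b, w} = g a + g w + (g b + g w)"
        using side[of a] side[of b] by (simp only: insert_iff simp_thms)
      also have "\<dots> = g a + g w + (g w + g b)" by (simp only: add.commute)
      finally show ?thesis by (simp only: bit_add_cancel)
    qed (use that edge_good in blast)
    \<comment> \<open>This default value puts the edges at \<open>v\<close> into the same formula as
      all others.\<close>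
    have "g v = 0" by (simp add: g_def)
    have "f {x, y} = g x + g y" if "{x, y} \<in> edges ?H" for x y
    proof -
      have xy: "x \<in> V" "y \<in> V" "x \<in> nbrs G y" using that edge_H by auto
      consider "x = v" | "y = v" | "x \<noteq> v" "y \<noteq> v" by blast
      then show ?thesis
      proof cases
        case 1
        then show ?thesis using edge_v[of y] xy \<open>g v = 0\<close> by (simp only: add_0)
      next
        case 2
        then have "f {y, x} = g x" using edge_v[of x] xy nbrs_sym by blast
        then show ?thesis using 2 \<open>g v = 0\<close> by (simp only: add_0_right insert_commute)
      next
        case 3
        then show ?thesis using edge_any xy by blast
      qed
    qed
    then show "\<exists>g. \<forall>x y. {x, y} \<in> edges ?H \<longrightarrow> f {x, y} = g x + g y" by blast
  qed
qed

section \<open>Comparison of the two invariants\<close>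

lemma min_degree_1_eq:
  "min_degree 1 G = (INF e \<in> edges G. enat (card (common_nbrs G e)))"
  using simplices_clique_complex_1[OF simple] by (simp add: min_degree_def)

theorem cohom_connectivity_eq_min_degree:
  "cohom_connectivity TYPE(bit) 1 G = min_degree 1 G"
proof (rule antisym)
  show "cohom_connectivity TYPE(bit) 1 G \<le> min_degree 1 G"
    unfolding min_degree_1_eq
  proof (rule INF_greatest)
    fix e assume e: "e \<in> edges G"
    with simple have "card e = 2" by (simp add: finite_simple_graph_def)
    then obtain a b where "e = {a, b}" by (auto simp: card_2_iff)
    moreover have "common_nbrs G {a, b} \<subseteq> verts G"
      using nbrs_subset by (auto simp: common_nbrs_def)
    ultimately show "cohom_connectivity TYPE(bit) 1 G \<le> enat (card (common_nbrs G e))"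
      unfolding cohom_connectivity_def
      using nontrivial_delete_common_nbrs[of a b] e by (intro INF_lower) auto
  qed
next
  show "min_degree 1 G \<le> cohom_connectivity TYPE(bit) 1 G"
    unfolding cohom_connectivity_def
  proof (rule INF_greatest, rule ccontr)
    fix C
    assume C: "C \<in> {C. C \<subseteq> verts G \<and> \<not> trivial_group
        (reduced_cohomology TYPE(bit) (int 1) (clique_complex (delete_verts G C)))}"
      and "\<not> min_degree 1 G \<le> enat (card C)"
    then have less: "enat (card C) < min_degree 1 G" by simp
    have "card C < card (common_nbrs G {a, b})" if "{a, b} \<in> edges G" for a b
    proof -
      have "enat (card C) < enat (card (common_nbrs G {a, b}))"
        using less INF_lower[OF that] unfolding min_degree_1_eq by (rule less_le_trans)
      then show ?thesis by simp
    qed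
    then show False using C trivial_delete_verts[of C] by simp
  qed
qed

end

section \<open>Random graphs are pseudorandom\<close>

text \<open>Events determined by disjoint blocks of independent coins are independent, so
  Hoeffding's inequality applies to the sum of their indicators, which counts the events that
  occur.\<close>

lemma Hoeffding_Pi_pmf_blocks:
  fixes q :: "'a \<Rightarrow> 'c::countable pmf" and dflt :: 'c
  assumes E: "finite E" and J: "finite J" "J \<noteq> {}"
    and K: "\<And>j. j \<in> J \<Longrightarrow> K j \<subseteq> E" "disjoint_family_on K J"
    and Q: "\<And>j X Y. j \<in> J \<Longrightarrow> (\<And>e. e \<in> K j \<Longrightarrow> X e = Y e) \<Longrightarrow> Q j X \<longleftrightarrow> Q j Y"
    and \<epsilon>: "0 \<le> \<epsilon>"
  defines "M \<equiv> Pi_pmf E dflt q"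
  defines "\<mu> \<equiv> \<Sum>j\<in>J. measure_pmf.prob M {X. Q j X}"
  shows Hoeffding_Pi_pmf_blocks_ge:
      "measure_pmf.prob M {X. \<mu> + \<epsilon> \<le> real (card {j \<in> J. Q j X})} \<le> exp (- 2 * \<epsilon>\<^sup>2 / card J)"
    and Hoeffding_Pi_pmf_blocks_le:
      "measure_pmf.prob M {X. real (card {j \<in> J. Q j X}) \<le> \<mu> - \<epsilon>} \<le> exp (- 2 * \<epsilon>\<^sup>2 / card J)"
proof -
  define Y where "Y j X = (of_bool (Q j X) :: real)" for j X
  have "prob_space.indep_vars (measure_pmf M) (\<lambda>j. PiM (K j) (\<lambda>_. count_space UNIV)) (\<lambda>j X. restrict X (K j)) J"
    unfolding M_def
    using prob_space.indep_vars_restrict[OF measure_pmf.prob_space_axioms indep_vars_Pi_pmf[OF E] K]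
    by simp
  then have "prob_space.indep_vars (measure_pmf M) (\<lambda>_. borel) (\<lambda>j X. Y j (restrict X (K j))) J"
  proof (rule prob_space.indep_vars_compose2[OF measure_pmf.prob_space_axioms])
    fix j assume "j \<in> J"
    then have "finite (K j)" using K(1) E finite_subset by blast
    \<comment> \<open>A finite product of countable discrete spaces is discrete, which makes
      measurability automatic.\<close>
    then have "PiM (K j) (\<lambda>_. count_space (UNIV :: 'c set)) = count_space (PiE (K j) (\<lambda>_. UNIV))"
      by (intro count_space_PiM_finite) auto
    then show "Y j \<in> borel_measurable (PiM (K j) (\<lambda>_. count_space UNIV))" by simp
  qed
  also have "?this \<longleftrightarrow> prob_space.indep_vars (measure_pmf M) (\<lambda>_. borel) Y J"
  proof (rule prob_space.indep_vars_cong[OF measure_pmf.prob_space_axioms refl _ refl])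
    fix j assume j: "j \<in> J"
    show "(\<lambda>X. Y j (restrict X (K j))) = Y j"
    proof
      fix X show "Y j (restrict X (K j)) = Y j X"
        unfolding Y_def using Q[OF j, of "restrict X (K j)" X] by simp
    qed
  qed
  finally have indep: "prob_space.indep_vars (measure_pmf M) (\<lambda>_. borel) Y J" .
  have "Y j = indicat_real {X. Q j X}" for j by (auto simp: Y_def fun_eq_iff indicator_def)
  then have "measure_pmf.expectation M (Y j) = measure_pmf.prob M {X. Q j X}" for j by simp
  then have \<mu>: "\<mu> = (\<Sum>j\<in>J. measure_pmf.expectation M (Y j))" by (simp add: \<mu>_def)
  interpret Hoeffding_ineq "measure_pmf M" J Y "\<lambda>_. 0" "\<lambda>_. 1" \<mu>
  proof unfold_locales
    show "\<mu> \<equiv> \<Sum>j\<in>J. measure_pmf.expectation M (Y j)" by (rule eq_reflection[OF \<mu>])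
    show "AE X in measure_pmf M. Y j X \<in> {0..1}" for j by (rule always_eventually) (simp add: Y_def)
  qed (rule J indep)+
  have "(\<Sum>j\<in>J. Y j X) = card {j \<in> J. Q j X}" for X
    using J(1) by (simp add: Y_def Int_def)
  moreover have "0 < card J" using J by auto
  ultimately show "measure_pmf.prob M {X. \<mu> + \<epsilon> \<le> real (card {j \<in> J. Q j X})} \<le> exp (- 2 * \<epsilon>\<^sup>2 / card J)"
    and "measure_pmf.prob M {X. real (card {j \<in> J. Q j X}) \<le> \<mu> - \<epsilon>} \<le> exp (- 2 * \<epsilon>\<^sup>2 / card J)"
    using Hoeffding_ineq_ge[OF \<epsilon>] Hoeffding_ineq_le[OF \<epsilon>] by simp_all
qed

text \<open>The event is a box, prescribing the coins in \<open>S\<close> and \<open>F\<close> and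
  leaving the others free, so its probability factors.\<close>

lemma prob_Pi_pmf_bernoulli_pattern:
  assumes P: "finite P" "S \<subseteq> P" "F \<subseteq> P" "S \<inter> F = {}" and p: "0 \<le> p" "p \<le> 1"
  shows "measure_pmf.prob (Pi_pmf P False (\<lambda>_. bernoulli_pmf p)) {X. (\<forall>e\<in>S. X e) \<and> (\<forall>e\<in>F. \<not> X e)} =
    p ^ card S * (1 - p) ^ card F"
proof -
  let ?B = "\<lambda>e. if e \<in> S then {True} else if e \<in> F then {False} else UNIV"
  have "{X. (\<forall>e\<in>S. X e) \<and> (\<forall>e\<in>F. \<not> X e)} = Pi P ?B"
    using P(2-4) by (fastforce simp: Pi_def split: if_splits)
  then have "measure_pmf.prob (Pi_pmf P False (\<lambda>_. bernoulli_pmf p))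
      {X. (\<forall>e\<in>S. X e) \<and> (\<forall>e\<in>F. \<not> X e)} = (\<Prod>e\<in>P. measure_pmf.prob (bernoulli_pmf p) (?B e))"
    by (simp only: measure_Pi_pmf_Pi[OF P(1)])
  also have "\<dots> = (\<Prod>e\<in>P. (if e \<in> S then p else 1) * (if e \<in> F then 1 - p else 1))"
    using P(4) p by (intro prod.cong) (auto simp: measure_pmf_single)
  also have "\<dots> = (\<Prod>e\<in>P \<inter> S. p) * (\<Prod>e\<in>P \<inter> F. 1 - p)"
    by (simp only: prod.distrib prod.inter_restrict[OF P(1)])
  also have "P \<inter> S = S" using P(2) by auto
  also have "P \<inter> F = F" using P(3) by auto
  finally show ?thesis by simp
qed

section \<open>The coin model of the random graph and its tail bounds\<close>

definition edge_slots :: "nat \<Rightarrow> nat set set" where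
  "edge_slots n = {e. e \<subseteq> {1..n} \<and> card e = 2}"

definition edge_coins :: "nat \<Rightarrow> real \<Rightarrow> (nat set \<Rightarrow> bool) pmf" where
  "edge_coins n p = Pi_pmf (edge_slots n) False (\<lambda>_. bernoulli_pmf p)"

text \<open>The deterministic part of \<open>erdos_renyi\<close>: probabilities are computed on the
  independent coins and transported along this map.\<close>

definition coin_graph :: "nat \<Rightarrow> (nat set \<Rightarrow> bool) \<Rightarrow> nat sgraph" where
  "coin_graph n X = \<lparr>verts = {1..n}, edges = {e \<in> edge_slots n. X e}\<rparr>"

lemma erdos_renyi_eq: "erdos_renyi n p = map_pmf (coin_graph n) (edge_coins n p)"
  by (simp add: erdos_renyi_def edge_coins_def edge_slots_def coin_graph_def[abs_def])

lemma finite_edge_slots: "finite (edge_slots n)"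
  by (simp add: edge_slots_def)

lemma edge_slots_iff: "{x, y} \<in> edge_slots n \<longleftrightarrow> x \<in> {1..n} \<and> y \<in> {1..n} \<and> x \<noteq> y"
  by (auto simp: edge_slots_def card_insert_if)

lemma nbrs_coin_graph:
  "nbrs (coin_graph n X) y = {x. {x, y} \<in> edge_slots n \<and> X {x, y}}"
  by (simp add: nbrs_def coin_graph_def)

lemma finite_simple_coin_graph: "finite_simple_graph (coin_graph n X)"
  by (auto simp: finite_simple_graph_def coin_graph_def edge_slots_def)

text \<open>Disjointness makes \<open>{a, b}\<close> determine the pair, so
  \<open>card A * card B\<close> distinct coins must all fail.\<close>

lemma prob_no_edge_between:
  assumes A: "A \<subseteq> {1..n}" and B: "B \<subseteq> {1..n}" and "A \<inter> B = {}" and p: "0 \<le> p" "p \<le> 1"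
  shows "measure_pmf.prob (edge_coins n p) {X. \<forall>a\<in>A. \<forall>b\<in>B. \<not> X {a, b}} =
    (1 - p) ^ (card A * card B)"
proof -
  let ?F = "(\<lambda>(a, b). {a, b}) ` (A \<times> B)"
  have "card ?F = card (A \<times> B)"
    using assms(3) by (intro card_image) (auto simp: inj_on_def doubleton_eq_iff)
  moreover have "?F \<subseteq> edge_slots n"
  proof clarify
    fix a b assume "a \<in> A" "b \<in> B"
    then show "{a, b} \<in> edge_slots n" unfolding edge_slots_iff using assms(1-3) by blast
  qed
  ultimately have "measure_pmf.prob (edge_coins n p) {X. (\<forall>e\<in>{}. X e) \<and> (\<forall>e\<in>?F. \<not> X e)} =
      (1 - p) ^ (card A * card B)"
    unfolding edge_coins_def using p
    by (subst prob_Pi_pmf_bernoulli_pattern[OF finite_edge_slots]) (auto simp: card_cartesian_product)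
  also have "{X. (\<forall>e\<in>{}. X e) \<and> (\<forall>e\<in>?F. \<not> X e)} = {X. \<forall>a\<in>A. \<forall>b\<in>B. \<not> X {a, b}}" by auto
  finally show ?thesis .
qed

text \<open>Whether \<open>x\<close> is adjacent to \<open>c\<close> and \<open>d\<close> but not to
  \<open>a\<close> depends on three coins. For different \<open>x\<close> outside
  \<open>{a, c, d}\<close> these blocks are disjoint, so the block form of Hoeffding's inequality
  applies.\<close>

lemma prob_codegree_Diff_less:
  assumes acd: "a \<in> {1..n}" "c \<in> {1..n}" "d \<in> {1..n}" "a \<noteq> c" "a \<noteq> d" "c \<noteq> d"
    and n: "3 < n" and p: "0 \<le> p" "p \<le> 1" and \<epsilon>: "0 \<le> \<epsilon>"
  shows "measure_pmf.prob (edge_coins n p) {X. real (card (nbrs (coin_graph n X) c \<inter> nbrs (coin_graph n X) d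
      - nbrs (coin_graph n X) a - {a})) < (real n - 3) * (p\<^sup>2 * (1 - p)) - \<epsilon>} \<le> exp (- 2 * \<epsilon>\<^sup>2 / n)"
proof -
  define J where "J = {1..n} - {a, c, d}"
  define Q where "Q x X \<longleftrightarrow> X {x, c} \<and> X {x, d} \<and> \<not> X {x, a}" for x :: nat and X
  have card_J: "card J = n - 3" using acd by (simp add: J_def card_Diff_subset)
  then have "0 < card J" using n by simp
  then have J: "finite J" "J \<noteq> {}" using card_gt_0_iff by blast+
  have prob_Q: "measure_pmf.prob (edge_coins n p) {X. Q x X} = p\<^sup>2 * (1 - p)" if "x \<in> J" for x
  proof -
    have "{x, c} \<noteq> {x, d}" using acd by (auto simp: doubleton_eq_iff)
    then have card2: "card {{x, c}, {x, d}} = 2" by simp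
    have "measure_pmf.prob (edge_coins n p)
      {X. (\<forall>e\<in>{{x, c}, {x, d}}. X e) \<and> (\<forall>e\<in>{{x, a}}. \<not> X e)} = p ^ 2 * (1 - p) ^ card {{x, a}}"
      unfolding edge_coins_def card2[symmetric]
      using that acd p by (intro prob_Pi_pmf_bernoulli_pattern finite_edge_slots)
        (auto simp: J_def edge_slots_iff doubleton_eq_iff)
    then show ?thesis by (simp add: Q_def)
  qed
  have "measure_pmf.prob (edge_coins n p) {X. real (card {x \<in> J. Q x X}) \<le>
      (\<Sum>x\<in>J. measure_pmf.prob (edge_coins n p) {X. Q x X}) - \<epsilon>} \<le> exp (- 2 * \<epsilon>\<^sup>2 / card J)"
    unfolding edge_coins_def
    by (rule Hoeffding_Pi_pmf_blocks_le[where K = "\<lambda>x. {{x, c}, {x, d}, {x, a}}"])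
      (use J \<epsilon> acd in \<open>auto simp: finite_edge_slots J_def edge_slots_iff Q_def
         disjoint_family_on_def doubleton_eq_iff\<close>)
  also have "(\<Sum>x\<in>J. measure_pmf.prob (edge_coins n p) {X. Q x X}) = (real n - 3) * (p\<^sup>2 * (1 - p))"
    using prob_Q card_J n by simp
  \<comment> \<open>Replacing \<open>card J\<close> by \<open>n\<close> weakens the bound, but gives
    both codegree tails the same form.\<close>
  also have "exp (- 2 * \<epsilon>\<^sup>2 / card J) \<le> exp (- 2 * \<epsilon>\<^sup>2 / n)"
    using card_J n by (auto intro!: divide_left_mono)
  finally have *: "measure_pmf.prob (edge_coins n p) {X. real (card {x \<in> J. Q x X}) \<le>
      (real n - 3) * (p\<^sup>2 * (1 - p)) - \<epsilon>} \<le> exp (- 2 * \<epsilon>\<^sup>2 / n)" .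
  have le: "card {x \<in> J. Q x X} \<le> card (nbrs (coin_graph n X) c \<inter> nbrs (coin_graph n X) d
      - nbrs (coin_graph n X) a - {a})" for X
  proof (rule card_mono)
    show "finite (nbrs (coin_graph n X) c \<inter> nbrs (coin_graph n X) d - nbrs (coin_graph n X) a - {a})"
      by (rule finite_subset[of _ "{1..n}"]) (auto simp: nbrs_coin_graph edge_slots_iff)
  qed (use acd in \<open>auto simp: nbrs_coin_graph edge_slots_iff J_def Q_def\<close>)
  show ?thesis
  proof (rule order_trans[OF measure_pmf.finite_measure_mono *], clarify)
    fix X assume "real (card (nbrs (coin_graph n X) c \<inter> nbrs (coin_graph n X) d
      - nbrs (coin_graph n X) a - {a})) < (real n - 3) * (p\<^sup>2 * (1 - p)) - \<epsilon>"
    then show "real (card {x \<in> J. Q x X}) \<le> (real n - 3) * (p\<^sup>2 * (1 - p)) - \<epsilon>"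
      using of_nat_mono[OF le[of X], where 'a = real] by linarith
  qed simp
qed

text \<open>The upper tail uses blocks of two coins for each \<open>x\<close> outside
  \<open>{c, d}\<close>.\<close>

lemma prob_codegree_greater:
  assumes cd: "c \<in> {1..n}" "d \<in> {1..n}" "c \<noteq> d"
    and n: "3 < n" and p: "0 \<le> p" "p \<le> 1" and \<epsilon>: "0 \<le> \<epsilon>"
  shows "measure_pmf.prob (edge_coins n p) {X. real n * p\<^sup>2 + \<epsilon> <
      real (card (nbrs (coin_graph n X) c \<inter> nbrs (coin_graph n X) d))} \<le> exp (- 2 * \<epsilon>\<^sup>2 / n)"
proof -
  define J where "J = {1..n} - {c, d}"
  define Q where "Q x X \<longleftrightarrow> X {x, c} \<and> X {x, d}" for x :: nat and X
  have card_J: "card J = n - 2" using cd by (simp add: J_def card_Diff_subset)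
  then have "0 < card J" using n by simp
  then have J: "finite J" "J \<noteq> {}" using card_gt_0_iff by blast+
  have prob_Q: "measure_pmf.prob (edge_coins n p) {X. Q x X} = p\<^sup>2" if "x \<in> J" for x
  proof -
    have "{x, c} \<noteq> {x, d}" using cd by (auto simp: doubleton_eq_iff)
    then have card2: "card {{x, c}, {x, d}} = 2" by simp
    have "measure_pmf.prob (edge_coins n p)
      {X. (\<forall>e\<in>{{x, c}, {x, d}}. X e) \<and> (\<forall>e\<in>{}. \<not> X e)} = p ^ 2 * (1 - p) ^ card ({} :: nat set set)"
      unfolding edge_coins_def card2[symmetric]
      using that cd p by (intro prob_Pi_pmf_bernoulli_pattern finite_edge_slots)
        (auto simp: J_def edge_slots_iff doubleton_eq_iff)
    then show ?thesis by (simp add: Q_def)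
  qed
  have "measure_pmf.prob (edge_coins n p) {X. (\<Sum>x\<in>J. measure_pmf.prob (edge_coins n p) {X. Q x X}) + \<epsilon>
      \<le> real (card {x \<in> J. Q x X})} \<le> exp (- 2 * \<epsilon>\<^sup>2 / card J)"
    unfolding edge_coins_def
    by (rule Hoeffding_Pi_pmf_blocks_ge[where K = "\<lambda>x. {{x, c}, {x, d}}"])
      (use J \<epsilon> cd in \<open>auto simp: finite_edge_slots J_def edge_slots_iff Q_def
         disjoint_family_on_def doubleton_eq_iff\<close>)
  also have "(\<Sum>x\<in>J. measure_pmf.prob (edge_coins n p) {X. Q x X}) = (real n - 2) * p\<^sup>2"
    using prob_Q card_J n by simp
  also have "exp (- 2 * \<epsilon>\<^sup>2 / card J) \<le> exp (- 2 * \<epsilon>\<^sup>2 / n)"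
    using card_J n by (auto intro!: divide_left_mono)
  finally have *: "measure_pmf.prob (edge_coins n p) {X. (real n - 2) * p\<^sup>2 + \<epsilon>
      \<le> real (card {x \<in> J. Q x X})} \<le> exp (- 2 * \<epsilon>\<^sup>2 / n)" .
  have eq: "nbrs (coin_graph n X) c \<inter> nbrs (coin_graph n X) d = {x \<in> J. Q x X}" for X
    using cd by (auto simp: nbrs_coin_graph edge_slots_iff J_def Q_def)
  have "(real n - 2) * p\<^sup>2 \<le> real n * p\<^sup>2" by (intro mult_right_mono) auto
  then show ?thesis
    unfolding eq by (intro order_trans[OF measure_pmf.finite_measure_mono *]) auto
qed

section \<open>Union bounds over the failure events\<close>

lemma card_subsets_le_power:
  assumes "finite A"
  shows "finite {B. B \<subseteq> A \<and> card B = k}" "card {B. B \<subseteq> A \<and> card B = k} \<le> card A ^ k"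
proof -
  show "finite {B. B \<subseteq> A \<and> card B = k}" using assms by simp
  have "card A choose k \<le> card A ^ k"
    by (cases "k \<le> card A") (auto simp: binomial_le_pow binomial_eq_0)
  then show "card {B. B \<subseteq> A \<and> card B = k} \<le> card A ^ k" using n_subsets[OF assms] by simp
qed

lemma measure_pmf_UN_le:
  fixes b :: real
  assumes "finite I" "\<And>i. i \<in> I \<Longrightarrow> measure_pmf.prob q (A i) \<le> b" "real (card I) \<le> k" "0 \<le> b"
  shows "measure_pmf.prob q (\<Union>i\<in>I. A i) \<le> k * b"
proof -
  have "measure_pmf.prob q (\<Union>i\<in>I. A i) \<le> (\<Sum>i\<in>I. measure_pmf.prob q (A i))"
    by (rule measure_pmf.finite_measure_subadditive_finite) (use assms in auto)
  also have "\<dots> \<le> (\<Sum>i\<in>I. b)" using assms(2) by (rule sum_mono)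
  also have "\<dots> = real (card I) * b" by simp
  also have "\<dots> \<le> k * b" by (rule mult_right_mono[OF assms(3,4)])
  finally show ?thesis .
qed

text \<open>The failures are indexed by pairs of \<open>s\<close>-sets, by pairs of vertices and by
  triples of vertices; the crude counts \<open>n ^ (2 * s)\<close>, \<open>n ^ 2\<close> and
  \<open>n ^ 3\<close> are the factors in the bound.\<close>

lemma prob_pseudorandom_graph:
  assumes n: "3 < n" and p: "0 \<le> p" "p \<le> 1" and \<epsilon>: "0 \<le> \<epsilon>"
  defines "m \<equiv> (real n - 3) * (p\<^sup>2 * (1 - p)) - \<epsilon>" and "M \<equiv> real n * p\<^sup>2 + \<epsilon>"
  assumes gap: "M + 4 * real s ^ 2 + 4 * real s + 2 \<le> 2 * m" and M_le: "M + 3 \<le> real n"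
  shows "1 - (real n ^ (2 * s) * (1 - p) ^ (s * s) + (real n ^ 2 + real n ^ 3) * exp (- 2 * \<epsilon>\<^sup>2 / n))
    \<le> measure_pmf.prob (erdos_renyi n p) {G. pseudorandom_graph G s m M}"
proof -
  let ?V = "{1..n}" and ?q = "edge_coins n p"
  define I where "I = {A. A \<subseteq> ?V \<and> card A = s}"
  \<comment> \<open>Degenerate indices receive the empty event, so that the unions can run over full
    products.\<close>
  define E where "E AB = (if fst AB \<inter> snd AB = {} then {X. \<forall>a\<in>fst AB. \<forall>b\<in>snd AB. \<not> X {a, b}} else {})"
    for AB :: "nat set \<times> nat set"
  define U where "U cd = (if fst cd \<noteq> snd cd then {X. M < real (card
    (nbrs (coin_graph n X) (fst cd) \<inter> nbrs (coin_graph n X) (snd cd)))} else {})" for cd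
  define L where "L acd = (case acd of (a, c, d) \<Rightarrow> if a \<noteq> c \<and> a \<noteq> d \<and> c \<noteq> d then
    {X. real (card (nbrs (coin_graph n X) c \<inter> nbrs (coin_graph n X) d
      - nbrs (coin_graph n X) a - {a})) < m} else {})" for acd
  let ?E = "\<Union>(E ` (I \<times> I))" and ?U = "\<Union>(U ` (?V \<times> ?V))" and ?L = "\<Union>(L ` (?V \<times> ?V \<times> ?V))"
  have good: "pseudorandom_graph (coin_graph n X) s m M" if X: "X \<notin> ?E \<union> (?U \<union> ?L)" for X
  proof
    fix A B assume AB: "A \<subseteq> verts (coin_graph n X)" "B \<subseteq> verts (coin_graph n X)" "A \<inter> B = {}"
      "s \<le> card A" "s \<le> card B"
    \<comment> \<open>Subsets of size exactly \<open>s\<close> suffice, which keeps the union bound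
      small.\<close>
    obtain A' where A': "A' \<subseteq> A" "card A' = s" using obtain_subset_with_card_n[OF AB(4)] by blast
    obtain B' where B': "B' \<subseteq> B" "card B' = s" using obtain_subset_with_card_n[OF AB(5)] by blast
    have sub: "A' \<subseteq> ?V" "B' \<subseteq> ?V" "A' \<inter> B' = {}"
      using A' B' AB by (auto simp: coin_graph_def)
    then have "X \<notin> E (A', B')" using X A' B' by (auto simp: I_def)
    then obtain a b where "a \<in> A'" "b \<in> B'" "X {a, b}" using sub by (auto simp: E_def)
    moreover from this have "{a, b} \<in> edges (coin_graph n X)"
      using sub by (auto simp: coin_graph_def edge_slots_iff)
    ultimately show "\<exists>a\<in>A. \<exists>b\<in>B. {a, b} \<in> edges (coin_graph n X)" using A' B' by blast
  next
    fix c d assume cd: "c \<in> verts (coin_graph n X)" "d \<in> verts (coin_graph n X)" "c \<noteq> d"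
    then have "X \<notin> U (c, d)" using X by (auto simp: coin_graph_def)
    then show "real (card (nbrs (coin_graph n X) c \<inter> nbrs (coin_graph n X) d)) \<le> M"
      using cd by (simp add: U_def)
  next
    fix a c d assume acd: "a \<in> verts (coin_graph n X)" "c \<in> verts (coin_graph n X)"
      "d \<in> verts (coin_graph n X)" "a \<noteq> c" "a \<noteq> d" "c \<noteq> d"
    then have "X \<notin> L (a, c, d)" using X by (auto simp: coin_graph_def)
    then show "m \<le> real (card (nbrs (coin_graph n X) c \<inter> nbrs (coin_graph n X) d
        - nbrs (coin_graph n X) a - {a}))"
      using acd by (simp add: L_def)
  qed (use finite_simple_coin_graph gap M_le \<epsilon> in \<open>auto simp: coin_graph_def M_def\<close>)

  have "measure_pmf.prob ?q ?E \<le> real n ^ (2 * s) * (1 - p) ^ (s * s)"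
  proof (rule measure_pmf_UN_le)
    have "card I \<le> n ^ s" "finite I" using card_subsets_le_power[of ?V s] by (simp_all add: I_def)
    then show "finite (I \<times> I)" by simp
    have "card (I \<times> I) \<le> n ^ s * n ^ s"
      using \<open>card I \<le> n ^ s\<close> by (simp add: card_cartesian_product mult_le_mono)
    also have "\<dots> = n ^ (2 * s)" by (simp add: mult_2 power_add)
    finally show "real (card (I \<times> I)) \<le> real n ^ (2 * s)"
      by (metis of_nat_le_iff of_nat_power)
    fix AB assume "AB \<in> I \<times> I"
    then show "measure_pmf.prob ?q (E AB) \<le> (1 - p) ^ (s * s)"
      using prob_no_edge_between[OF _ _ _ p, of "fst AB" n "snd AB"] p by (auto simp: E_def I_def)
  qed (use p in simp)
  moreover have "measure_pmf.prob ?q ?U \<le> real n ^ 2 * exp (- 2 * \<epsilon>\<^sup>2 / n)"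
  proof (rule measure_pmf_UN_le)
    fix cd assume "cd \<in> ?V \<times> ?V"
    then show "measure_pmf.prob ?q (U cd) \<le> exp (- 2 * \<epsilon>\<^sup>2 / n)"
      using prob_codegree_greater[OF _ _ _ n p \<epsilon>, of "fst cd" "snd cd"] unfolding U_def M_def by auto
  qed (auto simp: card_cartesian_product power2_eq_square)
  moreover have "measure_pmf.prob ?q ?L \<le> real n ^ 3 * exp (- 2 * \<epsilon>\<^sup>2 / n)"
  proof (rule measure_pmf_UN_le)
    fix acd assume "acd \<in> ?V \<times> ?V \<times> ?V"
    then show "measure_pmf.prob ?q (L acd) \<le> exp (- 2 * \<epsilon>\<^sup>2 / n)"
      using prob_codegree_Diff_less[OF _ _ _ _ _ _ n p \<epsilon>, of "fst acd" "fst (snd acd)" "snd (snd acd)"]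
      unfolding L_def m_def by (auto split: prod.splits)
  qed (auto simp: card_cartesian_product power3_eq_cube)
  moreover have "measure_pmf.prob ?q (?E \<union> (?U \<union> ?L)) \<le>
      measure_pmf.prob ?q ?E + (measure_pmf.prob ?q ?U + measure_pmf.prob ?q ?L)"
    using measure_Un_le[of ?E ?q "?U \<union> ?L"] measure_Un_le[of ?U ?q ?L] by simp
  moreover have "1 - measure_pmf.prob ?q (?E \<union> (?U \<union> ?L)) =
      measure_pmf.prob ?q (- (?E \<union> (?U \<union> ?L)))"
    using measure_pmf.prob_compl[of "?E \<union> (?U \<union> ?L)" ?q] by (simp add: Compl_eq_Diff_UNIV)
  moreover have "\<dots> \<le> measure_pmf.prob ?q (coin_graph n -` {G. pseudorandom_graph G s m M})"
    using good by (intro measure_pmf.finite_measure_mono) auto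
  moreover have "\<dots> = measure_pmf.prob (erdos_renyi n p) {G. pseudorandom_graph G s m M}"
    by (simp add: erdos_renyi_eq)
  ultimately show ?thesis by (simp add: algebra_simps)
qed

section \<open>The middling regime\<close>

lemma middling_eventually_greater:
  assumes "middling d p" and nonneg: "\<And>n. n \<ge> 1 \<Longrightarrow> 0 \<le> p n"
  shows "\<forall>\<^sub>F n in sequentially. real n powr (- (1 / d)) < p n"
proof -
  have "ereal (- (1 / d)) < liminf (\<lambda>n. elog (real n) (p n))"
    using assms(1) by (simp add: middling_def ereal_uminus_less_reorder)
  then have "\<forall>\<^sub>F n in sequentially. ereal (- (1 / d)) < elog (real n) (p n)"
    by (rule less_LiminfD)
  with eventually_gt_at_top[of 1] show ?thesis
  proof eventually_elim
    case (elim n)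
    \<comment> \<open>The value \<open>p n = 0\<close> is excluded since \<open>elog\<close> is then
      minus infinity.\<close>
    then have "p n \<noteq> 0" "- (1 / d) < log (real n) (p n)"
      by (auto simp: elog_def split: if_splits)
    moreover have "0 \<le> p n" using elim by (intro nonneg) simp
    ultimately show ?case using elim by (simp add: less_log_iff)
  qed
qed

text \<open>In multiples of y = \<open>real n * p\<^sup>2\<close>, the left side of the gap is at
  most 1 + 1/6 + 1/5 and the right side at least 2 - 1/5 - 1/10 - 1/3. Both equal 41/30, so the
  constants fit exactly.\<close>

lemma pseudorandom_graph_parameters:
  fixes p :: real
  assumes n: "60 \<le> n" and p: "0 \<le> p" "p \<le> 1 / 10" and lower: "real n powr (4 / 5) \<le> real n * p\<^sup>2"
    and s: "real s \<le> real n powr (1 / 4) + 1"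
    and large: "4 * (real n powr (1 / 4) + 1)\<^sup>2 + 4 * (real n powr (1 / 4) + 1) + 2 \<le> real n powr (4 / 5) / 5"
  defines "\<epsilon> \<equiv> real n * p\<^sup>2 / 6"
  shows "(real n * p\<^sup>2 + \<epsilon>) + 4 * real s ^ 2 + 4 * real s + 2 \<le>
      2 * ((real n - 3) * (p\<^sup>2 * (1 - p)) - \<epsilon>)"
    and "(real n * p\<^sup>2 + \<epsilon>) + 3 \<le> real n"
proof -
  let ?y = "real n * p\<^sup>2"
  define r where "r = real n powr (1 / 4) + 1"
  have "(real s)\<^sup>2 \<le> r\<^sup>2" using s unfolding r_def by (intro power_mono) auto
  then have "4 * real s ^ 2 + 4 * real s + 2 \<le> ?y / 5"
    using s large lower unfolding r_def[symmetric] by linarith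
  moreover have "?y * p \<le> ?y * (1 / 10)" using p by (intro mult_left_mono) auto
  moreover have "60 * p\<^sup>2 \<le> ?y" using n by (intro mult_right_mono) auto
  moreover have "0 \<le> p\<^sup>2 * p" using p by simp
  ultimately show "(?y + \<epsilon>) + 4 * real s ^ 2 + 4 * real s + 2 \<le>
      2 * ((real n - 3) * (p\<^sup>2 * (1 - p)) - \<epsilon>)"
    unfolding \<epsilon>_def by (simp add: algebra_simps)
  have "p\<^sup>2 \<le> (1 / 10)\<^sup>2" using p by (intro power_mono) auto
  then have "?y \<le> real n * (1 / 100)" by (intro mult_left_mono) (auto simp: power2_eq_square)
  then show "(?y + \<epsilon>) + 3 \<le> real n" unfolding \<epsilon>_def using n by linarith
qed

text \<open>The product is at most the exponential of s (2 ln n - p s), and p s is at least n to the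
  power 1/4 - 1/10 = 3/20.\<close>

lemma edge_between_failure_le:
  assumes n: "1 \<le> n" and p: "0 \<le> p" "p \<le> 1" and s: "real n powr (1 / 4) \<le> real s"
    and lower: "real n powr (- (1 / 10)) \<le> p" and large: "2 * ln (real n) \<le> real n powr (3 / 20)"
  shows "real n ^ (2 * s) * (1 - p) ^ (s * s) \<le> exp (2 * ln (real n) - real n powr (3 / 20))"
proof -
  have "real n powr (3 / 20) = real n powr (- (1 / 10)) * real n powr (1 / 4)"
    by (simp flip: powr_add)
  also have "\<dots> \<le> p * real s" using s lower p by (intro mult_mono) auto
  finally have ps: "real n powr (3 / 20) \<le> p * real s" .
  have "1 \<le> real n powr (1 / 4)" using n by (simp add: ge_one_powr_ge_zero)
  then have s1: "1 \<le> real s" using s by linarith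
  have "(1 - p) ^ (s * s) \<le> exp (- p) ^ (s * s)"
    using p exp_ge_add_one_self[of "- p"] by (intro power_mono) auto
  then have "real n ^ (2 * s) * (1 - p) ^ (s * s) \<le> exp (ln (real n)) ^ (2 * s) * exp (- p) ^ (s * s)"
    using n p by (intro mult_mono) auto
  also have "\<dots> = exp (real s * (2 * ln (real n) - p * real s))"
    by (simp add: exp_of_nat_mult[symmetric] exp_add[symmetric] algebra_simps)
  also have "\<dots> \<le> exp (real s * (2 * ln (real n) - real n powr (3 / 20)))"
    using ps by (intro iffD2[OF exp_le_cancel_iff] mult_left_mono) auto
  \<comment> \<open>The bracket is nonpositive by \<open>large\<close>, so lowering the factor
    \<open>s\<close> to 1 only increases the exponent.\<close>
  also have "\<dots> \<le> exp (1 * (2 * ln (real n) - real n powr (3 / 20)))"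
    using s1 large by (intro iffD2[OF exp_le_cancel_iff] mult_right_mono_neg) auto
  finally show ?thesis by simp
qed

theorem theorem1p4:
  fixes p :: "nat \<Rightarrow> real"
  assumes "\<And>n. n \<ge> 1 \<Longrightarrow> p n \<in> {0..1}"
    and "middling 10 p"
  shows "(\<lambda>n. measure_pmf.prob (erdos_renyi n (p n))
            {G. cohom_connectivity TYPE(bit) 1 G = min_degree 1 G}) \<longlonglongrightarrow> 1"
proof -
  \<comment> \<open>An explicit failure bound: the exponent 3/20 comes from \<open>s\<close> times
    \<open>p\<close>, and 3/5 from \<open>real n * p n ^ 4\<close>.\<close>
  define g where "g n = exp (2 * ln (real n) - real n powr (3 / 20))
    + (real n ^ 2 + real n ^ 3) * exp (- (real n powr (3 / 5) / 18))" for n :: nat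
  have "g \<longlonglongrightarrow> 0" unfolding g_def by real_asymp
  then have lim: "(\<lambda>n. 1 - g n) \<longlonglongrightarrow> 1" by (auto intro!: tendsto_eq_intros)
  have "\<forall>\<^sub>F n in sequentially. p n < 1 / 10"
    using assms(2) by (intro order_tendstoD(2)[where y = 0]) (auto simp: middling_def)
  moreover have "\<forall>\<^sub>F n in sequentially. real n powr (- (1 / 10)) < p n"
    using assms by (intro middling_eventually_greater) auto
  moreover have "\<forall>\<^sub>F n :: nat in sequentially.
      4 * (real n powr (1 / 4) + 1)\<^sup>2 + 4 * (real n powr (1 / 4) + 1) + 2 \<le> real n powr (4 / 5) / 5"
    by real_asymp
  moreover have "\<forall>\<^sub>F n :: nat in sequentially. 2 * ln (real n) \<le> real n powr (3 / 20)"
    by real_asymp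
  ultimately have "\<forall>\<^sub>F n in sequentially. 1 - g n \<le> measure_pmf.prob (erdos_renyi n (p n))
      {G. cohom_connectivity TYPE(bit) 1 G = min_degree 1 G}"
    using eventually_ge_at_top[of 60]
  proof eventually_elim
    case (elim n)
    \<comment> \<open>With this size, \<open>s\<close> times \<open>p n\<close> dominates ln n,
      while the square of \<open>s\<close>, about the square root of \<open>n\<close>, stays far
      below the codegree scale \<open>real n powr (4 / 5)\<close>.\<close>
    define s where "s = nat \<lceil>real n powr (1 / 4)\<rceil>"
    \<comment> \<open>A fixed fraction of the expected codegree, so the Hoeffding exponent is of
      order \<open>real n * p n ^ 4\<close>.\<close>
    define \<epsilon> where "\<epsilon> = real n * (p n)\<^sup>2 / 6"
    have s: "real n powr (1 / 4) \<le> real s" "real s \<le> real n powr (1 / 4) + 1"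
      unfolding s_def by (simp_all add: real_nat_ceiling_ge of_nat_ceiling[THEN order_trans])
    have p: "0 \<le> p n" "p n \<le> 1" using assms(1)[of n] elim by auto
    have lower: "real n powr (- (1 / 10)) \<le> p n" using elim by linarith
    have "real n * (real n powr (- (1 / 10))) ^ 2 \<le> real n * (p n)\<^sup>2"
      by (rule mult_left_mono[OF power_mono[OF lower]]) simp_all
    moreover have "real n * (real n powr (- (1 / 10))) ^ 2 = real n powr (4 / 5)"
      using elim by (simp add: powr_power powr_mult_base)
    ultimately have lower2: "real n powr (4 / 5) \<le> real n * (p n)\<^sup>2" by simp
    have "real n * (real n powr (- (1 / 10))) ^ 4 \<le> real n * (p n) ^ 4"
      by (rule mult_left_mono[OF power_mono[OF lower]]) simp_all
    moreover have "real n * (real n powr (- (1 / 10))) ^ 4 = real n powr (3 / 5)"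
      using elim by (simp add: powr_power powr_mult_base)
    moreover have "2 * \<epsilon>\<^sup>2 / real n = real n * (p n) ^ 4 / 18"
      using elim by (simp add: \<epsilon>_def field_simps eval_nat_numeral)
    ultimately have "exp (- 2 * \<epsilon>\<^sup>2 / real n) \<le> exp (- (real n powr (3 / 5) / 18))" by simp
    then have "(real n ^ 2 + real n ^ 3) * exp (- 2 * \<epsilon>\<^sup>2 / real n) \<le>
        (real n ^ 2 + real n ^ 3) * exp (- (real n powr (3 / 5) / 18))"
      by (intro mult_left_mono) auto
    moreover have "real n ^ (2 * s) * (1 - p n) ^ (s * s) \<le> exp (2 * ln (real n) - real n powr (3 / 20))"
      using elim s p by (intro edge_between_failure_le) auto
    ultimately have "1 - g n \<le> 1 - (real n ^ (2 * s) * (1 - p n) ^ (s * s)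
        + (real n ^ 2 + real n ^ 3) * exp (- 2 * \<epsilon>\<^sup>2 / real n))"
      unfolding g_def by linarith
    also have "\<dots> \<le> measure_pmf.prob (erdos_renyi n (p n)) {G. pseudorandom_graph G s
        ((real n - 3) * ((p n)\<^sup>2 * (1 - p n)) - \<epsilon>) (real n * (p n)\<^sup>2 + \<epsilon>)}"
      using elim p pseudorandom_graph_parameters[of n "p n" s] lower2 s(2)
      by (intro prob_pseudorandom_graph) (auto simp: \<epsilon>_def)
    also have "\<dots> \<le> measure_pmf.prob (erdos_renyi n (p n))
        {G. cohom_connectivity TYPE(bit) 1 G = min_degree 1 G}"
      using pseudorandom_graph.cohom_connectivity_eq_min_degree
      by (intro measure_pmf.finite_measure_mono Collect_mono impI) (blast, simp)
    finally show ?case .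
  qed
  then show ?thesis
    by (intro tendsto_sandwich[OF _ _ lim tendsto_const]) (auto intro: always_eventually)
qed

end
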